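(* Assume the setting described in the context and that $u$ satisfies Assumption $( * )$. Let $(y,w)$ be a maximal solution of the integrated Maxey–Riley system with domain $[t_0,T)$, and suppose $T<\infty$. Then $(y,w)$ leaves every compact set as $t\to T$: for every compact set $S\subset\mathscr{D}\times\mathbb{R}^n$ there exists $\tau\in(t_0,T)$ such that $(y(t),w(t))\notin S$ for all $t\in(\tau,T)$.
   Context: Fix $n\ge 1$, a domain $\mathscr{D}\subseteq\mathbb{R}^n$, an initial time $t_0\ge 0$, a velocity field $u:\mathscr{D}\times[0,\infty)\to\mathbb{R}^n$, real constants $R,\mu,\kappa,\gamma>0$ and a constant vector $g\in\mathbb{R}^n$. Write $\frac{D}{Dt}=\partial_t+(u\cdot\nabla)$ and define $A_u,B_u:\mathscr{D}\times[t_0,\infty)\to\mathbb{R}^n$, $M_u:\mathscr{D}\times[t_0,\infty)\to\mathbb{R}^{n\times n}$ by $A_u=u+\frac{\gamma}{6}\mu^{-1}\Delta u$, $M_u=\nabla u+\frac{\gamma}{6}\mu^{-1}\nabla\Delta u$, $B_u=\left(\frac{3R}{2}-1\right)\left(\frac{Du}{Dt}-g\right)+\left(\frac{R}{20}-\frac16\right)\gamma\mu^{-1}\frac{D}{Dt}\Delta u-\frac{\gamma}{6}\mu^{-1}\left(\nabla u+\frac{\gamma}{6}\mu^{-1}\nabla\Delta u\right)\Delta u$. The integrated Maxey–Riley system is $y(t)=y_0+\int_{t_0}^t\big(w(s)+A_u(y(s),s)\big)\,ds$, $w(t)=w_0+\int_{t_0}^t\Big(-\mu w(s)-M_u(y(s),s)w(s)-\kappa\mu^{1/2}\frac{w(s)}{\sqrt{t-s}}+B_u(y(s),s)\Big)\,ds$.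 For $T\in(t_0,\infty]$, a solution with domain $[t_0,T)$ and initial condition $(y_0,w_0)$ is a pair of continuous maps $y:[t_0,T)\to\mathscr{D}$, $w:[t_0,T)\to\mathbb{R}^n$ satisfying both equations for every $t\in[t_0,T)$. A solution $(\tilde y,\tilde w)$ with domain $[t_0,\tilde T)$ is an extension of a solution $(y,w)$ with domain $[t_0,T)$ if $t_0<T<\tilde T$ and they agree on $[t_0,T)$; a solution is maximal if it has no extension. Assumption $( * )$: $u$ is smooth enough that the first-order partial derivatives in time and space of $A_u$ and $B_u$ exist, are continuous, and are uniformly bounded in time and space, i.e. there is $L_b$ with $\|\partial_tA_u\|_\infty,\|\nabla A_u\|_\infty,\|\partial_tB_u\|_\infty,\|\nabla B_u\|_\infty<L_b$. *)

theory Defs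
  imports "HOL-Analysis.Analysis"
begin

definition jac :: "(real^'n \<Rightarrow> real^'m) \<Rightarrow> real^'n \<Rightarrow> real^'n^'m" where
  "jac f x = matrix (frechet_derivative f (at x))"

definition lap :: "(real^'n \<Rightarrow> real^'m) \<Rightarrow> real^'n \<Rightarrow> real^'m" where
  "lap f x = (\<Sum>j\<in>UNIV. jac (\<lambda>y. jac f y *v axis j 1) x *v axis j 1)"

definition tder :: "(real \<Rightarrow> real^'m) \<Rightarrow> real set \<Rightarrow> real \<Rightarrow> real^'m" where
  "tder f S t = vector_derivative f (at t within S)"

definition DDt :: "(real^'n \<Rightarrow> real \<Rightarrow> real^'n) \<Rightarrow> (real^'n \<Rightarrow> real \<Rightarrow> real^'n)
    \<Rightarrow> real^'n \<Rightarrow> real \<Rightarrow> real^'n" where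
  "DDt u f x t = tder (\<lambda>s. f x s) {0..} t + jac (\<lambda>y. f y t) x *v u x t"

definition A_u :: "real \<Rightarrow> real \<Rightarrow> (real^'n \<Rightarrow> real \<Rightarrow> real^'n) \<Rightarrow> real^'n \<Rightarrow> real \<Rightarrow> real^'n" where
  "A_u \<gamma> \<mu> u x t = u x t + (\<gamma> / (6 * \<mu>)) *\<^sub>R lap (\<lambda>y. u y t) x"

definition M_u :: "real \<Rightarrow> real \<Rightarrow> (real^'n \<Rightarrow> real \<Rightarrow> real^'n) \<Rightarrow> real^'n \<Rightarrow> real \<Rightarrow> real^'n^'n" where
  "M_u \<gamma> \<mu> u x t = jac (\<lambda>y. u y t) x + (\<gamma> / (6 * \<mu>)) *\<^sub>R jac (\<lambda>y. lap (\<lambda>z. u z t) y) x"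

definition B_u :: "real \<Rightarrow> real \<Rightarrow> real \<Rightarrow> real^'n \<Rightarrow> (real^'n \<Rightarrow> real \<Rightarrow> real^'n)
    \<Rightarrow> real^'n \<Rightarrow> real \<Rightarrow> real^'n" where
  "B_u R \<gamma> \<mu> g u x t =
     (3 * R / 2 - 1) *\<^sub>R (DDt u u x t - g)
   + ((R / 20 - 1 / 6) * \<gamma> / \<mu>) *\<^sub>R DDt u (\<lambda>y s. lap (\<lambda>z. u z s) y) x t
   - (\<gamma> / (6 * \<mu>)) *\<^sub>R (M_u \<gamma> \<mu> u x t *v lap (\<lambda>y. u y t) x)"

section \<open>Regularity of u needed for the definitions to make sense\<close>

definition u_regular :: "(real^'n) set \<Rightarrow> real \<Rightarrow> (real^'n \<Rightarrow> real \<Rightarrow> real^'n) \<Rightarrow> bool" where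
  "u_regular D t0 u \<longleftrightarrow> (\<forall>x\<in>D. \<forall>t. t0 \<le> t \<longrightarrow>
      (\<lambda>y. u y t) differentiable (at x)
    \<and> (\<forall>j. (\<lambda>y. jac (\<lambda>z. u z t) y *v axis j 1) differentiable (at x))
    \<and> (\<lambda>y. lap (\<lambda>z. u z t) y) differentiable (at x)
    \<and> (\<lambda>s. u x s) differentiable (at t within {0..})
    \<and> (\<lambda>s. lap (\<lambda>z. u z s) x) differentiable (at t within {0..}))"

definition C1_bounded :: "(real^'n) set \<Rightarrow> real \<Rightarrow> (real^'n \<Rightarrow> real \<Rightarrow> real^'n) \<Rightarrow> real \<Rightarrow> bool" where
  "C1_bounded D t0 F L \<longleftrightarrow>
     (\<forall>x\<in>D. \<forall>t. t0 \<le> t \<longrightarrow>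
        (\<lambda>y. F y t) differentiable (at x)
      \<and> (\<lambda>s. F x s) differentiable (at t within {t0..})
      \<and> norm (jac (\<lambda>y. F y t) x) < L
      \<and> norm (tder (\<lambda>s. F x s) {t0..} t) < L)
   \<and> continuous_on (D \<times> {t0..}) (\<lambda>(x, t). jac (\<lambda>y. F y t) x)
   \<and> continuous_on (D \<times> {t0..}) (\<lambda>(x, t). tder (\<lambda>s. F x s) {t0..} t)"

definition assumption_star :: "(real^'n) set \<Rightarrow> real \<Rightarrow> real \<Rightarrow> real \<Rightarrow> real \<Rightarrow> real^'n
    \<Rightarrow> (real^'n \<Rightarrow> real \<Rightarrow> real^'n) \<Rightarrow> bool" where
  "assumption_star D t0 R \<gamma> \<mu> g u \<longleftrightarrow>
     (\<exists>Lb. C1_bounded D t0 (A_u \<gamma> \<mu> u) Lb \<and> C1_bounded D t0 (B_u R \<gamma> \<mu> g u) Lb)"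

definition MR_solution :: "(real^'n) set \<Rightarrow> real \<Rightarrow> real \<Rightarrow> real \<Rightarrow> real \<Rightarrow> real \<Rightarrow> real^'n
    \<Rightarrow> (real^'n \<Rightarrow> real \<Rightarrow> real^'n) \<Rightarrow> real^'n \<Rightarrow> real^'n \<Rightarrow> ereal
    \<Rightarrow> (real \<Rightarrow> real^'n) \<Rightarrow> (real \<Rightarrow> real^'n) \<Rightarrow> bool" where
  "MR_solution D t0 R \<mu> \<kappa> \<gamma> g u y0 w0 T y w \<longleftrightarrow>
     ereal t0 < T
   \<and> continuous_on {t. t0 \<le> t \<and> ereal t < T} y
   \<and> continuous_on {t. t0 \<le> t \<and> ereal t < T} w
   \<and> (\<forall>t. t0 \<le> t \<and> ereal t < T \<longrightarrow>
         y t \<in> D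
       \<and> ((\<lambda>s. w s + A_u \<gamma> \<mu> u (y s) s) has_integral (y t - y0)) {t0..t}
       \<and> ((\<lambda>s. - \<mu> *\<^sub>R w s - M_u \<gamma> \<mu> u (y s) s *v w s
                 - (\<kappa> * sqrt \<mu> / sqrt (t - s)) *\<^sub>R w s
                 + B_u R \<gamma> \<mu> g u (y s) s) has_integral (w t - w0)) {t0..t})"

definition MR_maximal :: "(real^'n) set \<Rightarrow> real \<Rightarrow> real \<Rightarrow> real \<Rightarrow> real \<Rightarrow> real \<Rightarrow> real^'n
    \<Rightarrow> (real^'n \<Rightarrow> real \<Rightarrow> real^'n) \<Rightarrow> real^'n \<Rightarrow> real^'n \<Rightarrow> ereal
    \<Rightarrow> (real \<Rightarrow> real^'n) \<Rightarrow> (real \<Rightarrow> real^'n) \<Rightarrow> bool" where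
  "MR_maximal D t0 R \<mu> \<kappa> \<gamma> g u y0 w0 T y w \<longleftrightarrow>
     MR_solution D t0 R \<mu> \<kappa> \<gamma> g u y0 w0 T y w
   \<and> \<not> (\<exists>T' y' w'. T < T' \<and> MR_solution D t0 R \<mu> \<kappa> \<gamma> g u y0 w0 T' y' w'
          \<and> (\<forall>t. t0 \<le> t \<and> ereal t < T \<longrightarrow> y' t = y t \<and> w' t = w t))"

end

(* The coefficient M is only known to be continuous, not Lipschitz, in y, so the contraction
   principle does not apply and continuation has to be obtained by compactness.  If a solution on
   [t0, T) meets a compact subset of the phase space at times accumulating at T, then first
   phi = |w| + |A| + |B| is bounded along it: A and B are Lipschitz along the curve at a rate
   controlled by phi, so on a short final interval phi grows by at most half its maximum.  The
   right-hand sides are then bounded, the solution is Hoelder continuous of order 1/2, and it has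
   a limit in the phase space at T.  A Peano-type theorem for the Volterra equation with the Abel
   kernel, with the whole past prescribed, extends the solution beyond T. *)

theory Submission
  imports Defs "HOL-Complex_Analysis.Great_Picard"
begin

section \<open>Volterra equations with the Abel kernel\<close>

text \<open>Neither A nor B is assumed bounded, and between two visits to the compact set the curve
  may wander, so compactness alone bounds nothing. What helps is that the position equation has no
  singular kernel: y moves at speed at most |w| + |A|, so the locally Lipschitz fields A and B
  change along the curve at a rate affine in the maximum of phi. The bound on M comes with that on
  the derivatives of A, because M is the gradient of A. The Abel term depends on the whole history
  through a kernel that changes with t. A solution therefore cannot simply be restarted at T from
  its final value, and the memory estimates take suprema from t0 on. Velocities stay bounded up to a
  finite T, so the role of the compact set is to place the limit of the position inside D. Both
  equations are merged into one, z = h + V(z) in the product space, with an ordinary density G and a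
  density P that carries the weight 1/sqrt(t - s).\<close>

lemma has_integral_abel_kernel:
  fixes t :: real
  assumes "c \<le> d" "d \<le> t"
  shows "((\<lambda>s. 1 / sqrt (t - s)) has_integral (2 * sqrt (t - c) - 2 * sqrt (t - d))) {c..d}"
proof -
  have "((\<lambda>s. 1 / sqrt (t - s)) has_integral (- 2 * sqrt (t - d) - (- 2 * sqrt (t - c)))) {c..d}"
  \<comment> \<open>The interior version admits d = t, where the integrand is singular but its
    primitive -2 sqrt(t - s) stays continuous.\<close>
  proof (rule fundamental_theorem_of_calculus_interior[OF assms(1)])
    show "continuous_on {c..d} (\<lambda>s. - 2 * sqrt (t - s))"
      by (intro continuous_intros)
    fix x assume "x \<in> {c<..<d}"
    then have "t - x > 0" using assms by auto
    then have "((\<lambda>s. - 2 * sqrt (t - s)) has_real_derivative 1 / sqrt (t - x)) (at x)"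
      by (auto intro!: derivative_eq_intros simp: field_simps)
    then show "((\<lambda>s. - 2 * sqrt (t - s)) has_vector_derivative 1 / sqrt (t - x)) (at x)"
      by (simp add: has_real_derivative_iff_has_vector_derivative)
  qed
  then show ?thesis by (simp add: algebra_simps)
qed

text \<open>Nonnegativity makes the kernel absolutely integrable, and this survives multiplication
  by a bounded measurable function.\<close>

lemma abel_integrable:
  fixes f :: "real \<Rightarrow> 'e::euclidean_space"
  assumes "c \<le> d" "d \<le> t" and f: "continuous_on {c..d} f"
  shows "(\<lambda>s. (1 / sqrt (t - s)) *\<^sub>R f s) integrable_on {c..d}"
proof -
  have "(\<lambda>s. 1 / sqrt (t - s)) absolutely_integrable_on {c..d}"
    using has_integral_abel_kernel[OF assms(1,2)] assms(2)
    by (intro nonnegative_absolutely_integrable_1) (auto simp: has_integral_integrable)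
  moreover have "bounded (f ` {c..d})"
    using f by (simp add: compact_continuous_image compact_imp_bounded)
  moreover have "f \<in> borel_measurable (lebesgue_on {c..d})"
    using f by (simp add: continuous_imp_measurable_on_sets_lebesgue)
  ultimately have "(\<lambda>s. (1 / sqrt (t - s)) *\<^sub>R f s) absolutely_integrable_on {c..d}"
    using absolutely_integrable_bounded_measurable_product[of "\<lambda>x r. r *\<^sub>R x" f "{c..d}" "\<lambda>s. 1 / sqrt (t - s)"]
      bounded_bilinear.flip[OF bounded_bilinear_scaleR]
    by (simp add: bilinear_conv_bounded_bilinear)
  then show ?thesis
    using set_lebesgue_integral_eq_integral(1) by blast
qed

lemma norm_abel_integral_le:
  fixes f :: "real \<Rightarrow> 'e::euclidean_space"
  assumes "c \<le> d" "d \<le> t" and f: "continuous_on {c..d} f"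
    and C: "\<And>s. s \<in> {c..d} \<Longrightarrow> norm (f s) \<le> C"
  shows "norm (integral {c..d} (\<lambda>s. (1 / sqrt (t - s)) *\<^sub>R f s))
    \<le> C * (2 * sqrt (t - c) - 2 * sqrt (t - d))"
proof -
  note K = has_integral_mult_right[OF has_integral_abel_kernel[OF assms(1,2)], of C]
  have "norm (integral {c..d} (\<lambda>s. (1 / sqrt (t - s)) *\<^sub>R f s))
    \<le> integral {c..d} (\<lambda>s. C * (1 / sqrt (t - s)))"
    using abel_integrable[OF assms(1-3)] K C assms(2)
    by (intro integral_norm_bound_integral)
      (auto simp: has_integral_integrable divide_right_mono intro: has_integral_integrable)
  also have "\<dots> = C * (2 * sqrt (t - c) - 2 * sqrt (t - d))"
    using K by (rule integral_unique)
  finally show ?thesis .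
qed

text \<open>The oscillation is controlled by the sup norm of \<open>f\<close> alone, uniformly in the
  modulus of continuity of \<open>f\<close>.\<close>

lemma abel_integral_Holder:
  fixes f :: "real \<Rightarrow> 'e::euclidean_space"
  assumes "a \<le> t" "t \<le> t'" and f: "continuous_on {a..t'} f"
    and C: "\<And>s. s \<in> {a..t'} \<Longrightarrow> norm (f s) \<le> C"
  shows "norm (integral {a..t'} (\<lambda>s. (1 / sqrt (t' - s)) *\<^sub>R f s)
             - integral {a..t} (\<lambda>s. (1 / sqrt (t - s)) *\<^sub>R f s)) \<le> 4 * C * sqrt (t' - t)"
proof -
  have C0: "0 \<le> C" using order_trans[OF norm_ge_zero C[of a]] assms(1,2) by auto
  have f1: "continuous_on {a..t} f" and f2: "continuous_on {t..t'} f"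
    using assms(1,2) by (auto intro: continuous_on_subset[OF f])
  let ?i = "\<lambda>r s. (1 / sqrt (r - s)) *\<^sub>R f s"
  have split: "integral {a..t'} (?i t') = integral {a..t} (?i t') + integral {t..t'} (?i t')"
    using assms abel_integrable[of a t' t' f]
    by (intro Henstock_Kurzweil_Integration.integral_combine[symmetric]) auto
  have i1: "?i t integrable_on {a..t}" and i2: "?i t' integrable_on {a..t}"
    using abel_integrable assms f1 by blast+
  \<comment> \<open>For s < t the kernel decreases when its upper time moves from t to t'. The
    difference of kernels thus has a sign, and C times it is a majorant with an explicit
    integral.\<close>
  let ?k = "\<lambda>s. C * (1 / sqrt (t - s) - 1 / sqrt (t' - s))"
  have "(?k has_integral C * ((2 * sqrt (t - a) - 2 * sqrt (t - t)) - (2 * sqrt (t' - a) - 2 * sqrt (t' - t)))) {a..t}"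
    using assms(1,2) by (intro has_integral_mult_right has_integral_diff has_integral_abel_kernel) auto
  note k = this
  have "norm (integral {a..t} (?i t' ) - integral {a..t} (?i t))
      = norm (integral {a..t} (\<lambda>s. ?i t' s - ?i t s))"
    using i1 i2 by (simp add: Henstock_Kurzweil_Integration.integral_diff)
  \<comment> \<open>The endpoint s = t is removed: there 1 / sqrt 0 evaluates to 0, so
    \<open>?k\<close> can be negative at that point.\<close>
  also have "\<dots> \<le> integral {a..<t} ?k"
  proof -
    have "integral {a..t} (\<lambda>s. ?i t' s - ?i t s) = integral {a..<t} (\<lambda>s. ?i t' s - ?i t s)"
      by (rule integral_subset_negligible[symmetric]) (auto intro: negligible_subset[of "{t}"])
    moreover have "norm (integral {a..<t} (\<lambda>s. ?i t' s - ?i t s)) \<le> integral {a..<t} ?k"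
    proof (rule integral_norm_bound_integral)
      show "(\<lambda>s. ?i t' s - ?i t s) integrable_on {a..<t}"
        using integrable_diff[OF i2 i1]
        by (rule integrable_spike_set) (auto intro: negligible_subset[of "{t}"])
      show "?k integrable_on {a..<t}"
        using has_integral_integrable[OF k]
        by (rule integrable_spike_set) (auto intro: negligible_subset[of "{t}"])
      fix s assume s: "s \<in> {a..<t}"
      then have le: "1 / sqrt (t' - s) \<le> 1 / sqrt (t - s)"
        using assms(2) by (intro divide_left_mono) auto
      have "norm (?i t' s - ?i t s) = \<bar>1 / sqrt (t' - s) - 1 / sqrt (t - s)\<bar> * norm (f s)"
        by (simp flip: scaleR_diff_left)
      also have "\<dots> = (1 / sqrt (t - s) - 1 / sqrt (t' - s)) * norm (f s)"
        using le by simp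
      also have "\<dots> \<le> (1 / sqrt (t - s) - 1 / sqrt (t' - s)) * C"
        using le s assms(2) by (intro mult_left_mono C) auto
      finally show "norm (?i t' s - ?i t s) \<le> ?k s" by (simp add: mult.commute)
    qed
    ultimately show ?thesis by simp
  qed
  also have "integral {a..<t} ?k = integral {a..t} ?k"
    by (rule integral_subset_negligible) (auto intro: negligible_subset[of "{t}"])
  also have "\<dots> = C * (2 * sqrt (t' - t) - (2 * sqrt (t' - a) - 2 * sqrt (t - a)))"
    using integral_unique[OF k] by (simp add: algebra_simps)
  also have "\<dots> \<le> C * (2 * sqrt (t' - t))"
    using assms(2) C0 by (intro mult_left_mono) auto
  finally have 1: "norm (integral {a..t} (?i t') - integral {a..t} (?i t)) \<le> C * (2 * sqrt (t' - t))" .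
  \<comment> \<open>Second half of the constant 4: on the new piece the kernel has mass 2 sqrt(t' -
    t), equal to the bound for the change of kernel on the old one.\<close>
  have "norm (integral {t..t'} (?i t')) \<le> C * (2 * sqrt (t' - t))"
    using norm_abel_integral_le[of t t' t' f C] assms f2 by auto
  with 1 show ?thesis
    unfolding split using norm_triangle_ineq[of "integral {a..t} (?i t') - integral {a..t} (?i t)" "integral {t..t'} (?i t')"]
    by (simp add: algebra_simps)
qed

text \<open>The weight depends on the upper limit t, so increments of this operator are not
  integrals over the added interval alone.\<close>

definition volterra :: "real \<Rightarrow> (real \<Rightarrow> 'e::euclidean_space) \<Rightarrow> (real \<Rightarrow> 'e) \<Rightarrow> real \<Rightarrow> 'e" where
  "volterra a f p t = integral {a..t} (\<lambda>s. f s + (1 / sqrt (t - s)) *\<^sub>R p s)"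

lemma volterra_integrable:
  fixes f p :: "real \<Rightarrow> 'e::euclidean_space"
  assumes "a \<le> t" "continuous_on {a..t} f" "continuous_on {a..t} p"
  shows "(\<lambda>s. f s + (1 / sqrt (t - s)) *\<^sub>R p s) integrable_on {a..t}"
  using assms by (intro integrable_add integrable_continuous_real abel_integrable) auto

lemma volterra_Holder:
  fixes f p :: "real \<Rightarrow> 'e::euclidean_space"
  assumes "a \<le> t" "t \<le> t'" and f: "continuous_on {a..t'} f" and p: "continuous_on {a..t'} p"
    and C: "\<And>s. s \<in> {a..t'} \<Longrightarrow> norm (f s) \<le> C" "\<And>s. s \<in> {a..t'} \<Longrightarrow> norm (p s) \<le> C"
  shows "norm (volterra a f p t' - volterra a f p t) \<le> C * (t' - t) + 4 * C * sqrt (t' - t)"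
proof -
  have f1: "continuous_on {a..t} f" "continuous_on {a..t} p" "continuous_on {t..t'} f"
    using assms(1,2) by (auto intro: continuous_on_subset[OF f] continuous_on_subset[OF p])
  have eq: "volterra a f p r = integral {a..r} f + integral {a..r} (\<lambda>s. (1 / sqrt (r - s)) *\<^sub>R p s)"
    if "a \<le> r" "r \<le> t'" for r
    unfolding volterra_def using that
    by (intro Henstock_Kurzweil_Integration.integral_add integrable_continuous_real abel_integrable)
      (auto intro: continuous_on_subset[OF f] continuous_on_subset[OF p])
  have "integral {a..t'} f = integral {a..t} f + integral {t..t'} f"
    using assms integrable_continuous_real[OF f]
    by (intro Henstock_Kurzweil_Integration.integral_combine[symmetric]) auto
  moreover have "norm (integral {t..t'} f) \<le> C * (t' - t)"
    using integral_bound[OF assms(2) f1(3), of C] C assms(1) by auto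
  moreover note abel_integral_Holder[OF assms(1,2) p C(2)]
  ultimately show ?thesis
    using assms(1,2) norm_triangle_ineq[of "integral {t..t'} f" "integral {a..t'} (\<lambda>s. (1 / sqrt (t' - s)) *\<^sub>R p s)
             - integral {a..t} (\<lambda>s. (1 / sqrt (t - s)) *\<^sub>R p s)"]
    by (simp add: eq algebra_simps)
qed

lemma volterra_cong:
  assumes "\<And>s. s \<in> {a..t} \<Longrightarrow> f s = f' s" "\<And>s. s \<in> {a..t} \<Longrightarrow> p s = p' s"
  shows "volterra a f p t = volterra a f' p' t"
  unfolding volterra_def using assms by (intro integral_cong) auto

text \<open>Closure of S under initial segments from a treats closed intervals [a, b] and half-open
  intervals [a, T) at once.\<close>

lemma volterra_Holder_on:
  fixes f p :: "real \<Rightarrow> 'e::euclidean_space"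
  assumes S: "\<And>t. t \<in> S \<Longrightarrow> a \<le> t \<and> {a..t} \<subseteq> S"
    and f: "continuous_on S f" and p: "continuous_on S p"
    and C: "\<And>s. s \<in> S \<Longrightarrow> norm (f s) \<le> C" "\<And>s. s \<in> S \<Longrightarrow> norm (p s) \<le> C"
    and "t \<in> S" "t' \<in> S"
  shows "norm (volterra a f p t' - volterra a f p t) \<le> C * \<bar>t' - t\<bar> + 4 * C * sqrt \<bar>t' - t\<bar>"
proof -
  have *: "norm (volterra a f p r' - volterra a f p r) \<le> C * (r' - r) + 4 * C * sqrt (r' - r)"
    if "r \<in> S" "r' \<in> S" "r \<le> r'" for r r'
    using S[OF that(1)] S[OF that(2)] C that(3)
    by (intro volterra_Holder continuous_on_subset[OF f] continuous_on_subset[OF p]) auto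
  show ?thesis
    using *[of t t'] *[of t' t] assms(6,7)
      norm_minus_commute[of "volterra a f p t'" "volterra a f p t"]
    by (cases "t \<le> t'") auto
qed

text \<open>The modulus depends only on C and the distance of the times, so it does not degrade near
  an open end of S; this is what later produces a limit there.\<close>

lemma uniformly_continuous_on_volterra:
  fixes f p :: "real \<Rightarrow> 'e::euclidean_space"
  assumes S: "\<And>t. t \<in> S \<Longrightarrow> a \<le> t \<and> {a..t} \<subseteq> S"
    and f: "continuous_on S f" and p: "continuous_on S p"
    and C: "\<And>s. s \<in> S \<Longrightarrow> norm (f s) \<le> C" "\<And>s. s \<in> S \<Longrightarrow> norm (p s) \<le> C"
  shows "uniformly_continuous_on S (volterra a f p)"
  unfolding uniformly_continuous_on_def
proof (intro allI impI)
  fix \<epsilon> :: real assume "\<epsilon> > 0"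
  have "((\<lambda>r. C * \<bar>r\<bar> + 4 * C * sqrt \<bar>r\<bar>) \<longlongrightarrow> C * \<bar>0\<bar> + 4 * C * sqrt \<bar>0\<bar>) (at 0)"
    by (intro tendsto_intros)
  then have "\<forall>\<^sub>F r in at 0. C * \<bar>r\<bar> + 4 * C * sqrt \<bar>r\<bar> < \<epsilon>"
    by (rule order_tendstoD(2)) (use \<open>\<epsilon> > 0\<close> in simp)
  then obtain \<delta> where \<delta>: "\<delta> > 0"
    "\<And>r. r \<noteq> 0 \<Longrightarrow> \<bar>r\<bar> < \<delta> \<Longrightarrow> C * \<bar>r\<bar> + 4 * C * sqrt \<bar>r\<bar> < \<epsilon>"
    unfolding eventually_at by (auto simp: dist_real_def)
  have "dist (volterra a f p t') (volterra a f p t) < \<epsilon>"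
    if "t \<in> S" "t' \<in> S" "dist t' t < \<delta>" for t t'
    using volterra_Holder_on[OF S f p C that(1,2)] \<delta>(2)[of "t' - t"] that(3) \<open>\<epsilon> > 0\<close>
    by (cases "t' = t") (auto simp: dist_norm)
  with \<delta>(1) show "\<exists>\<delta>>0. \<forall>t\<in>S. \<forall>t'\<in>S. dist t' t < \<delta> \<longrightarrow> dist (volterra a f p t') (volterra a f p t) < \<epsilon>"
    by blast
qed

lemma continuous_on_volterra:
  fixes f p :: "real \<Rightarrow> 'e::euclidean_space"
  assumes f: "continuous_on {a..b} f" and p: "continuous_on {a..b} p"
  shows "continuous_on {a..b} (volterra a f p)"
proof -
  have "bounded (f ` {a..b} \<union> p ` {a..b})"
    using f p by (simp add: compact_continuous_image compact_imp_bounded)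
  then obtain C where "\<And>s. s \<in> {a..b} \<Longrightarrow> norm (f s) \<le> C" "\<And>s. s \<in> {a..b} \<Longrightarrow> norm (p s) \<le> C"
    unfolding bounded_iff by (metis UnI1 UnI2 imageI)
  then have "uniformly_continuous_on {a..b} (volterra a f p)"
    by (intro uniformly_continuous_on_volterra[OF _ f p]) auto
  then show ?thesis by (rule uniformly_continuous_imp_continuous)
qed

section \<open>Existence and continuation for the Volterra equation\<close>

text \<open>Peano existence with prescribed past \<open>\<zeta>\<close>: Tonelli's delayed equations are solved exactly
  by finitely many iterations, and the Hoelder bound feeds the Arzela--Ascoli theorem.\<close>

lemma volterra_extension:
  fixes G P :: "real \<times> 'e::euclidean_space \<Rightarrow> 'e"
  assumes ac: "a \<le> c" and cb: "c \<le> b"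
    and G: "continuous_on UNIV G" and P: "continuous_on UNIV P"
    and GC: "\<And>x. norm (G x) \<le> C" and PC: "\<And>x. norm (P x) \<le> C"
    and \<zeta>: "continuous_on {a..c} \<zeta>"
    and \<zeta>_eq: "\<And>t. t \<in> {a..c} \<Longrightarrow> \<zeta> t = h + volterra a (\<lambda>s. G (s, \<zeta> s)) (\<lambda>s. P (s, \<zeta> s)) t"
  obtains z where "continuous_on {a..b} z" "\<And>t. t \<in> {a..c} \<Longrightarrow> z t = \<zeta> t"
    "\<And>t. t \<in> {a..b} \<Longrightarrow> z t = h + volterra a (\<lambda>s. G (s, z s)) (\<lambda>s. P (s, z s)) t"
proof -
  define \<Phi> where "\<Phi> z t = h + volterra a (\<lambda>s. G (s, z s)) (\<lambda>s. P (s, z s)) t" for z t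
  have \<Phi>_cong: "\<Phi> z t = \<Phi> z' t" if "\<And>s. s \<in> {a..t} \<Longrightarrow> z s = z' s" for z z' t
    unfolding \<Phi>_def using that by (auto intro!: volterra_cong)
  have contG: "continuous_on S (\<lambda>s. G (s, z s))" "continuous_on S (\<lambda>s. P (s, z s))"
    if "continuous_on S z" for z and S :: "real set"
    using that by (auto intro!: continuous_on_compose2[OF G] continuous_on_compose2[OF P] continuous_intros)
  have \<Phi>_cont: "continuous_on {a..b} (\<Phi> z)" if "continuous_on {a..b} z" for z
    unfolding \<Phi>_def using that by (intro continuous_intros continuous_on_volterra contG)
  have C0: "0 \<le> C" using order_trans[OF norm_ge_zero GC] .
  define \<omega> where "\<omega> r = C * \<bar>r\<bar> + 4 * C * sqrt \<bar>r\<bar>" for r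
  have \<Phi>_Holder: "norm (\<Phi> z t' - \<Phi> z t) \<le> \<omega> (t' - t)"
    if z: "continuous_on {a..b} z" and t: "t \<in> {a..b}" "t' \<in> {a..b}" for z t t'
    using volterra_Holder_on[OF _ contG[OF z] GC PC t, of a] t
    by (simp add: \<Phi>_def \<omega>_def)
  \<comment> \<open>The delay acts only beyond c: up to c it is the identity, so the prescribed past
    still solves the delayed equation, and after c it looks back by \<epsilon> but never before
    c.\<close>
  define d where "d \<epsilon> s = min s (max c (s - \<epsilon>))" for \<epsilon> s :: real
  have d_cont: "continuous_on S (d \<epsilon>)" for \<epsilon> S
    unfolding d_def by (intro continuous_intros)
  have d_in: "d \<epsilon> s \<in> {a..b}" if "s \<in> {a..b}" for \<epsilon> s
    using that ac cb by (auto simp: d_def)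
  have comp: "continuous_on {a..b} (z \<circ> d \<epsilon>)" if "continuous_on {a..b} z" for z \<epsilon>
    by (rule continuous_on_compose[OF d_cont continuous_on_subset[OF that]]) (use d_in in blast)
  have delayed: "\<exists>z. continuous_on {a..b} z \<and> (\<forall>t\<in>{a..c}. z t = \<zeta> t) \<and> (\<forall>t\<in>{a..b}. z t = \<Phi> (z \<circ> d \<epsilon>) t)"
    if e: "\<epsilon> > 0" for \<epsilon>
  proof -
    \<comment> \<open>The iteration starts from the past frozen at its end values outside [a, c],
      which is continuous on all of [a, b].\<close>
    define Z where "Z k = ((\<lambda>z. \<Phi> (z \<circ> d \<epsilon>)) ^^ k) (\<lambda>s. \<zeta> (max a (min s c)))" for k
    have Z0: "Z 0 = (\<lambda>s. \<zeta> (max a (min s c)))" and ZS: "Z (Suc k) = \<Phi> (Z k \<circ> d \<epsilon>)" for k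
      by (auto simp: Z_def)
    have contZ: "continuous_on {a..b} (Z k)" for k
    proof (induction k)
      case 0
      show ?case unfolding Z0 using ac
        by (intro continuous_on_compose2[OF \<zeta>] continuous_intros) auto
    next
      case (Suc k)
      then show ?case unfolding ZS by (intro \<Phi>_cont comp)
    qed
    have past: "\<forall>t\<in>{a..c}. Z k t = \<zeta> t" for k
    proof (induction k)
      case (Suc k)
      show ?case
      proof
        fix t assume t: "t \<in> {a..c}"
        have "Z (Suc k) t = \<Phi> \<zeta> t"
          unfolding ZS using Suc e t by (intro \<Phi>_cong) (auto simp: d_def min_def max_def)
        then show "Z (Suc k) t = \<zeta> t" using \<zeta>_eq[OF t] by (simp add: \<Phi>_def)
      qed
    qed (simp add: Z0)
    \<comment> \<open>Each iteration makes one more strip of length \<epsilon> final, because the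
      delayed argument of a time in that strip lies in the strips already settled. Finitely many
      strips cover [c, b].\<close>
    have stable: "\<forall>t\<in>{a..b}. t \<le> c + real k * \<epsilon> \<longrightarrow> Z (Suc k) t = Z k t" for k
    proof (induction k)
      case 0
      then show ?case using past by simp
    next
      case (Suc k)
      show ?case
      proof (intro ballI impI)
        fix t assume t: "t \<in> {a..b}" "t \<le> c + real (Suc k) * \<epsilon>"
        have "Z (Suc k) (d \<epsilon> s) = Z k (d \<epsilon> s)" if s: "s \<in> {a..t}" for s
        proof -
          have "s - \<epsilon> \<le> c + real k * \<epsilon>" using s t by (auto simp: algebra_simps)
          moreover have "c \<le> c + real k * \<epsilon>" using e by simp
          ultimately have "d \<epsilon> s \<le> c + real k * \<epsilon>" by (auto simp: d_def)
          then show ?thesis using Suc d_in s t by auto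
        qed
        then have "\<Phi> (Z (Suc k) \<circ> d \<epsilon>) t = \<Phi> (Z k \<circ> d \<epsilon>) t"
          by (intro \<Phi>_cong) simp
        then show "Z (Suc (Suc k)) t = Z (Suc k) t" by (simp only: ZS)
      qed
    qed
    obtain N where "b - c < real N * \<epsilon>" using reals_Archimedean3[OF e] by blast
    then have "\<forall>t\<in>{a..b}. Z N t = \<Phi> (Z N \<circ> d \<epsilon>) t" using stable[of N] by (simp add: ZS)
    with contZ past show ?thesis by blast
  qed
  define e where "e n = 1 / real (Suc n)" for n
  have "\<forall>n. \<exists>z. continuous_on {a..b} z \<and> (\<forall>t\<in>{a..c}. z t = \<zeta> t) \<and> (\<forall>t\<in>{a..b}. z t = \<Phi> (z \<circ> d (e n)) t)"
    using delayed by (simp add: e_def)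
  then obtain z where z: "\<And>n. continuous_on {a..b} (z n)"
    and z_past: "\<And>n t. t \<in> {a..c} \<Longrightarrow> z n t = \<zeta> t"
    and z_eq: "\<And>n t. t \<in> {a..b} \<Longrightarrow> z n t = \<Phi> (z n \<circ> d (e n)) t"
    by metis
  have zd: "continuous_on {a..b} (z n \<circ> d (e n))" for n
    by (rule comp[OF z])
  have z_Holder: "norm (z n t' - z n t) \<le> \<omega> (t' - t)" if "t \<in> {a..b}" "t' \<in> {a..b}" for n t t'
    using \<Phi>_Holder[OF zd that, of n] unfolding z_eq[OF that(1), symmetric] z_eq[OF that(2), symmetric] .
  have \<omega>_lim: "(\<omega> \<longlongrightarrow> 0) (at 0)"
  proof -
    have "(\<omega> \<longlongrightarrow> C * \<bar>0\<bar> + 4 * C * sqrt \<bar>0\<bar>) (at 0)" unfolding \<omega>_def by (intro tendsto_intros)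
    then show ?thesis by simp
  qed
  have \<omega>0: "\<omega> 0 = 0" by (simp add: \<omega>_def)
  have \<omega>_small: "\<exists>\<delta>>0. \<forall>r. \<bar>r\<bar> < \<delta> \<longrightarrow> \<omega> r < \<epsilon>" if "\<epsilon> > 0" for \<epsilon>
  proof -
    have "\<forall>\<^sub>F r in at 0. \<omega> r < \<epsilon>" using \<omega>_lim that by (rule order_tendstoD)
    then obtain \<delta> where "\<delta> > 0" "\<And>r. r \<noteq> 0 \<Longrightarrow> \<bar>r\<bar> < \<delta> \<Longrightarrow> \<omega> r < \<epsilon>"
      unfolding eventually_at by auto
    then show ?thesis using \<omega>0 that by metis
  qed
  have z_bound: "norm (z n t) \<le> norm (\<zeta> a) + \<omega> (b - a)" if t: "t \<in> {a..b}" for n t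
  proof -
    have "norm (z n t - z n a) \<le> \<omega> (t - a)" using z_Holder t ac cb by simp
    also have "\<dots> \<le> \<omega> (b - a)" using t C0
      by (auto simp: \<omega>_def intro!: add_mono mult_left_mono)
    finally show ?thesis using z_past[of a n] ac norm_triangle_sub[of "z n t" "z n a"] by simp
  qed
  obtain g k where g: "continuous_on {a..b} g" and k: "strict_mono (k :: nat \<Rightarrow> nat)"
    and conv: "\<And>\<epsilon>. 0 < \<epsilon> \<Longrightarrow> \<exists>N. \<forall>n x. n \<ge> N \<and> x \<in> {a..b} \<longrightarrow> norm (z (k n) x - g x) < \<epsilon>"
  \<comment> \<open>Bounds and equicontinuity are uniform in the delay: the global bound C on the
    fields gives every \<open>z n\<close> the same modulus \<open>\<omega>\<close>.\<close>
  proof (rule Arzela_Ascoli[of "{a..b}" z "norm (\<zeta> a) + \<omega> (b - a)"])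
    fix x \<epsilon> :: real assume x: "x \<in> {a..b}" and "\<epsilon> > 0"
    then obtain \<delta> where "\<delta> > 0" "\<And>r. \<bar>r\<bar> < \<delta> \<Longrightarrow> \<omega> r < \<epsilon>" using \<omega>_small by blast
    moreover have "norm (z n x - z n y) \<le> \<omega> (x - y)" if "y \<in> {a..b}" for n y
      using z_Holder x that by blast
    ultimately show "\<exists>\<delta>>0. \<forall>n y. y \<in> {a..b} \<and> norm (x - y) < \<delta> \<longrightarrow> norm (z n x - z n y) < \<epsilon>"
      by (intro exI[of _ \<delta>]) (auto intro: order_le_less_trans)
  qed (use z_bound in auto)
  have lim: "(\<lambda>n. z (k n) x) \<longlonglongrightarrow> g x" if "x \<in> {a..b}" for x
    using conv that unfolding LIMSEQ_iff by meson
  have e_lim: "(\<lambda>n. e (k n)) \<longlonglongrightarrow> 0"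
    using LIMSEQ_subseq_LIMSEQ[OF LIMSEQ_inverse_real_of_nat k]
    by (simp add: e_def o_def inverse_eq_divide)
  \<comment> \<open>The shift caused by the delay tends to 0, and the common modulus turns this into
    convergence of the delayed values to the same limit.\<close>
  have lim_d: "(\<lambda>n. z (k n) (d (e (k n)) x)) \<longlonglongrightarrow> g x" if x: "x \<in> {a..b}" for x
  proof -
    have "(\<lambda>n. d (e (k n)) x - x) \<longlonglongrightarrow> min x (max c (x - 0)) - x"
      unfolding d_def by (intro tendsto_intros e_lim)
    then have d_lim: "(\<lambda>n. d (e (k n)) x - x) \<longlonglongrightarrow> 0" by (simp add: min_def max_def split: if_splits)
    have "isCont \<omega> 0" using \<omega>_lim by (simp add: isCont_def \<omega>0)
    from isCont_tendsto_compose[OF this d_lim] have "(\<lambda>n. \<omega> (d (e (k n)) x - x)) \<longlonglongrightarrow> 0" unfolding \<omega>0 .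
    then have "(\<lambda>n. z (k n) (d (e (k n)) x) - z (k n) x) \<longlonglongrightarrow> 0"
      by (rule Lim_null_comparison[rotated]) (use z_Holder x d_in in auto)
    from tendsto_add[OF this lim[OF x]] show ?thesis by simp
  qed
  have g_eq: "g t = \<Phi> g t" if t: "t \<in> {a..b}" for t
  proof -
    let ?f = "\<lambda>z s. G (s, z s) + (1 / sqrt (t - s)) *\<^sub>R P (s, z s)"
    have int: "?f z integrable_on {a..t}" if "continuous_on {a..b} z" for z
      using t continuous_on_subset[OF that, of "{a..t}"] by (intro volterra_integrable contG) auto
    have "(\<lambda>n. integral {a..t} (?f (z (k n) \<circ> d (e (k n))))) \<longlonglongrightarrow> integral {a..t} (?f g)"
    \<comment> \<open>The majorant C + C / sqrt(t - s) is independent of n, and it is itself a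
      Volterra integrand with constant densities.\<close>
    proof (rule dominated_convergence(2))
      show "(\<lambda>s. C + (1 / sqrt (t - s)) *\<^sub>R C) integrable_on {a..t}"
        using t by (intro volterra_integrable) auto
      show "?f (z (k n) \<circ> d (e (k n))) integrable_on {a..t}" for n by (rule int[OF zd])
    next
      fix n s assume s: "s \<in> {a..t}"
      have "(1 / sqrt (t - s)) * norm (P (s, y)) \<le> (1 / sqrt (t - s)) * C" for y
        using s PC by (intro mult_left_mono) auto
      then show "norm (?f (z (k n) \<circ> d (e (k n))) s) \<le> C + (1 / sqrt (t - s)) *\<^sub>R C"
        using s by (intro norm_triangle_mono GC) auto
    next
      fix s assume s: "s \<in> {a..t}"
      then have "(\<lambda>n. (s, (z (k n) \<circ> d (e (k n))) s)) \<longlonglongrightarrow> (s, g s)"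
        using lim_d t by (auto intro!: tendsto_intros)
      then show "(\<lambda>n. ?f (z (k n) \<circ> d (e (k n))) s) \<longlonglongrightarrow> ?f g s"
        using continuous_on_tendsto_compose[OF G] continuous_on_tendsto_compose[OF P]
        by (auto intro!: tendsto_intros)
    qed
    then have "(\<lambda>n. \<Phi> (z (k n) \<circ> d (e (k n))) t) \<longlonglongrightarrow> \<Phi> g t"
      unfolding \<Phi>_def volterra_def by (intro tendsto_intros)
    then have "(\<lambda>n. z (k n) t) \<longlonglongrightarrow> \<Phi> g t" using z_eq[OF t] by simp
    with lim[OF t] show ?thesis by (rule LIMSEQ_unique)
  qed
  show thesis
  proof (rule that[OF g])
    fix t assume t: "t \<in> {a..c}"
    then have "(\<lambda>n. \<zeta> t) \<longlonglongrightarrow> g t" using lim[of t] z_past cb by simp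
    then show "g t = \<zeta> t" by (simp add: LIMSEQ_const_iff)
  qed (use g_eq in \<open>simp add: \<Phi>_def\<close>)
qed

text \<open>Reduction to globally bounded fields. The compact set \<open>K\<close> joins the graph
  of the past to a box after c; Tietze extends the fields from \<open>K\<close> with the same bound.
  By continuity the resulting solution remains in \<open>K\<close> for a short time, where extended
  and original fields agree.\<close>

lemma volterra_continuation:
  fixes G P :: "real \<times> 'e::euclidean_space \<Rightarrow> 'e"
  assumes "a \<le> c" and \<Omega>: "open \<Omega>"
    and G: "continuous_on ({a..} \<times> \<Omega>) G" and P: "continuous_on ({a..} \<times> \<Omega>) P"
    and \<zeta>: "continuous_on {a..c} \<zeta>" and \<zeta>\<Omega>: "\<And>t. t \<in> {a..c} \<Longrightarrow> \<zeta> t \<in> \<Omega>"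
    and \<zeta>_eq: "\<And>t. t \<in> {a..c} \<Longrightarrow> \<zeta> t = h + volterra a (\<lambda>s. G (s, \<zeta> s)) (\<lambda>s. P (s, \<zeta> s)) t"
  obtains b z where "c < b" "continuous_on {a..b} z" "\<And>t. t \<in> {a..c} \<Longrightarrow> z t = \<zeta> t"
    "\<And>t. t \<in> {a..b} \<Longrightarrow> z t \<in> \<Omega>"
    "\<And>t. t \<in> {a..b} \<Longrightarrow> z t = h + volterra a (\<lambda>s. G (s, z s)) (\<lambda>s. P (s, z s)) t"
proof -
  have "\<zeta> c \<in> \<Omega>" using \<zeta>\<Omega> assms(1) by simp
  then obtain r where r: "r > 0" "cball (\<zeta> c) r \<subseteq> \<Omega>" using \<Omega> open_contains_cball by blast
  define K where "K = (\<lambda>s. (s, \<zeta> s)) ` {a..c} \<union> {c..c+1} \<times> cball (\<zeta> c) r"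
  have "compact K"
    unfolding K_def using \<zeta>
    by (intro compact_Un compact_Times compact_continuous_image continuous_intros) auto
  have K_sub: "K \<subseteq> {a..} \<times> \<Omega>" using assms(1) r(2) \<zeta>\<Omega> by (auto simp: K_def)
  have "bounded (G ` K \<union> P ` K)"
    using \<open>compact K\<close> K_sub G P
    by (auto intro!: compact_imp_bounded compact_continuous_image elim: continuous_on_subset)
  then obtain C where C: "C > 0" "\<And>x. x \<in> K \<Longrightarrow> norm (G x) \<le> C" "\<And>x. x \<in> K \<Longrightarrow> norm (P x) \<le> C"
    unfolding bounded_pos by auto
  have clK: "closedin (top_of_set UNIV) K" using \<open>compact K\<close> compact_imp_closed by auto
  obtain G' where G': "continuous_on UNIV G'" "\<And>x. x \<in> K \<Longrightarrow> G' x = G x" "\<And>x. norm (G' x) \<le> C"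
    using Tietze[OF continuous_on_subset[OF G K_sub] clK, of C] C by (metis UNIV_I less_imp_le)
  obtain P' where P': "continuous_on UNIV P'" "\<And>x. x \<in> K \<Longrightarrow> P' x = P x" "\<And>x. norm (P' x) \<le> C"
    using Tietze[OF continuous_on_subset[OF P K_sub] clK, of C] C by (metis UNIV_I less_imp_le)
  have "\<zeta> t = h + volterra a (\<lambda>s. G' (s, \<zeta> s)) (\<lambda>s. P' (s, \<zeta> s)) t" if "t \<in> {a..c}" for t
  proof -
    have "volterra a (\<lambda>s. G' (s, \<zeta> s)) (\<lambda>s. P' (s, \<zeta> s)) t = volterra a (\<lambda>s. G (s, \<zeta> s)) (\<lambda>s. P (s, \<zeta> s)) t"
      using that by (intro volterra_cong G'(2) P'(2)) (auto simp: K_def)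
    with \<zeta>_eq[OF that] show ?thesis by simp
  qed
  with assms(1) obtain z where z: "continuous_on {a..c+1} z" "\<And>t. t \<in> {a..c} \<Longrightarrow> z t = \<zeta> t"
    and z_eq: "\<And>t. t \<in> {a..c+1} \<Longrightarrow> z t = h + volterra a (\<lambda>s. G' (s, z s)) (\<lambda>s. P' (s, z s)) t"
    using volterra_extension[of a c "c + 1" G' P' C \<zeta> h] G' P' \<zeta> by auto
  obtain \<delta> where \<delta>: "\<delta> > 0" "\<And>s. s \<in> {a..c+1} \<Longrightarrow> dist s c < \<delta> \<Longrightarrow> dist (z s) (z c) < r"
    using z(1) r(1) assms(1) unfolding continuous_on_iff by force
  \<comment> \<open>The 1 keeps time inside the box; half of \<open>\<delta>\<close> makes the
    continuity estimate hold up to and including b.\<close>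
  define b where "b = c + min 1 (\<delta> / 2)"
  have b: "c < b" "b \<le> c + 1" "b - c < \<delta>" using \<delta>(1) by (auto simp: b_def min_def)
  have zc: "z c = \<zeta> c" using z(2) assms(1) by simp
  have inK: "(s, z s) \<in> K" if "s \<in> {a..b}" for s
  proof (cases "s \<le> c")
    case True
    then show ?thesis using that z(2) by (auto simp: K_def)
  next
    case False
    then have "dist (z s) (z c) < r" using that b assms(1) by (intro \<delta>(2)) (auto simp: dist_real_def)
    then show ?thesis using False that b zc by (auto simp: K_def dist_commute)
  qed
  show thesis
  proof (rule that[OF b(1)])
    show "continuous_on {a..b} z" using z(1) by (rule continuous_on_subset) (use b in auto)
    fix t assume t: "t \<in> {a..b}"
    show "z t \<in> \<Omega>" using inK[OF t] K_sub by auto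
    have "volterra a (\<lambda>s. G' (s, z s)) (\<lambda>s. P' (s, z s)) t = volterra a (\<lambda>s. G (s, z s)) (\<lambda>s. P (s, z s)) t"
      using t by (intro volterra_cong G'(2) P'(2) inK) auto
    then show "z t = h + volterra a (\<lambda>s. G (s, z s)) (\<lambda>s. P (s, z s)) t"
      using z_eq[of t] t b by simp
  qed (use z(2) in auto)
qed

section \<open>Lipschitz bounds from bounded first derivatives\<close>

text \<open>The norm on the matrix type is the Frobenius norm, so Cauchy-Schwarz in each row
  suffices.\<close>

lemma norm_matrix_vector_mult_le:
  fixes A :: "real^'n^'m"
  shows "norm (A *v x) \<le> norm A * norm x"
proof -
  have "norm (A *v x) = L2_set (\<lambda>i. norm ((A *v x) $ i)) UNIV" by (rule norm_vec_def)
  also have "\<dots> \<le> L2_set (\<lambda>i. norm (A $ i) * norm x) UNIV"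
    by (intro L2_set_mono) (auto simp: matrix_vector_mul_component intro: Cauchy_Schwarz_ineq2)
  also have "\<dots> = norm A * norm x" by (simp add: norm_vec_def[of A] L2_set_left_distrib)
  finally show ?thesis .
qed

lemma has_derivative_jac:
  fixes f :: "real^'n \<Rightarrow> real^'m"
  assumes "f differentiable (at x)"
  shows "(f has_derivative (\<lambda>h. jac f x *v h)) (at x)"
proof -
  have "(f has_derivative frechet_derivative f (at x)) (at x)"
    using assms frechet_derivative_works by blast
  moreover from this have "jac f x *v h = frechet_derivative f (at x) h" for h
    unfolding jac_def by (metis matrix_vector_mul(2) has_derivative_linear)
  ultimately show ?thesis by simp
qed

lemma jac_eqI: "jac f x = J" if "(f has_derivative (\<lambda>h. J *v h)) (at x)"
  unfolding jac_def frechet_derivative_at[OF that, symmetric] by simp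

text \<open>Since D may fail to be convex, a derivative bound gives a Lipschitz estimate only on
  balls inside D; the time half-line is convex and appears in full.\<close>

definition ball_Lipschitz ::
    "'a::real_normed_vector set \<Rightarrow> real \<Rightarrow> ('a \<Rightarrow> real \<Rightarrow> 'b::real_normed_vector) \<Rightarrow> real \<Rightarrow> bool" where
  "ball_Lipschitz D t0 F L \<longleftrightarrow> (\<forall>x r. ball x r \<subseteq> D \<longrightarrow>
     (\<forall>x1\<in>ball x r. \<forall>x2\<in>ball x r. \<forall>t1\<ge>t0. \<forall>t2\<ge>t0.
        norm (F x1 t1 - F x2 t2) \<le> L * (norm (x1 - x2) + \<bar>t1 - t2\<bar>)))"

text \<open>The mean value inequality is applied twice: in space at the fixed time t1, then in time
  at the fixed point x2, with the derivative taken within the half-line.\<close>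

lemma C1_bounded_imp_ball_Lipschitz:
  fixes F :: "real^'n \<Rightarrow> real \<Rightarrow> real^'n"
  assumes F: "C1_bounded D t0 F L"
  shows "ball_Lipschitz D t0 F L"
  unfolding ball_Lipschitz_def
proof (intro allI impI ballI)
  fix x r x1 x2 t1 t2
  assume "ball x r \<subseteq> D" and x: "x1 \<in> ball x r" "x2 \<in> ball x r" and t: "t0 \<le> t1" "t0 \<le> t2"
  note assms = assms this
  have "norm (F x1 t1 - F x2 t1) \<le> L * norm (x1 - x2)"
  proof (rule differentiable_bound[of "ball x r" _ "\<lambda>z h. jac (\<lambda>y. F y t1) z *v h"])
    fix z assume "z \<in> ball x r"
    then have z: "z \<in> D" using assms by blast
    then have "(\<lambda>y. F y t1) differentiable (at z)" using F t by (auto simp: C1_bounded_def)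
    from has_derivative_at_withinI[OF has_derivative_jac[OF this]]
    show "((\<lambda>y. F y t1) has_derivative (\<lambda>h. jac (\<lambda>y. F y t1) z *v h)) (at z within ball x r)" .
    have "norm (jac (\<lambda>y. F y t1) z) \<le> L" using F z t by (auto simp: C1_bounded_def less_imp_le)
    then show "onorm (\<lambda>h. jac (\<lambda>y. F y t1) z *v h) \<le> L"
      by (intro onorm_le order_trans[OF norm_matrix_vector_mult_le] mult_right_mono) auto
  qed (use x in auto)
  moreover have "norm (F x2 t1 - F x2 t2) \<le> L * norm (t1 - t2)"
  proof (rule differentiable_bound[of "{t0..}" _ "\<lambda>s h. h *\<^sub>R tder (\<lambda>s. F x2 s) {t0..} s"])
    have x2: "x2 \<in> D" using x assms by blast
    fix s assume s: "s \<in> {t0..}"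
    have "((\<lambda>s. F x2 s) has_vector_derivative tder (\<lambda>s. F x2 s) {t0..} s) (at s within {t0..})"
      using F x2 s unfolding tder_def vector_derivative_works[symmetric] by (auto simp: C1_bounded_def)
    then show "((\<lambda>s. F x2 s) has_derivative (\<lambda>h. h *\<^sub>R tder (\<lambda>s. F x2 s) {t0..} s)) (at s within {t0..})"
      by (simp add: has_vector_derivative_def)
    have "norm (tder (\<lambda>s. F x2 s) {t0..} s) \<le> L" using F x2 s by (auto simp: C1_bounded_def less_imp_le)
    then show "onorm (\<lambda>h. h *\<^sub>R tder (\<lambda>s. F x2 s) {t0..} s) \<le> L"
      by (intro onorm_le) (subst norm_scaleR, subst mult.commute, simp add: mult_right_mono)
  qed (use t in auto)
  ultimately show "norm (F x1 t1 - F x2 t2) \<le> L * (norm (x1 - x2) + \<bar>t1 - t2\<bar>)"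
    using norm_triangle_ineq[of "F x1 t1 - F x2 t1" "F x2 t1 - F x2 t2"] by (simp add: algebra_simps)
qed

text \<open>\<open>C1_bounded\<close> gives differentiability of F in each variable separately;
  joint continuity of F is recovered from the joint Lipschitz estimate on a ball.\<close>

lemma ball_Lipschitz_imp_continuous_on:
  assumes D: "open D" and F: "ball_Lipschitz D t0 F L"
  shows "continuous_on (D \<times> {t0..}) (\<lambda>(x, t). F x t)"
  unfolding continuous_on_def
proof clarsimp
  fix x t assume x: "x \<in> D" and t: "t0 \<le> t"
  obtain r where r: "r > 0" "ball x r \<subseteq> D" using D x open_contains_ball by blast
  let ?F = "at (x, t) within D \<times> {t0..}"
  have "((\<lambda>q. L * (norm (fst q - x) + \<bar>snd q - t\<bar>)) \<longlongrightarrow> L * (norm (fst (x, t) - x) + \<bar>snd (x, t) - t\<bar>)) ?F"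
    by (intro tendsto_intros)
  then have lim: "((\<lambda>q. L * (norm (fst q - x) + \<bar>snd q - t\<bar>)) \<longlongrightarrow> 0) ?F" by simp
  have "\<forall>\<^sub>F q in ?F. q \<in> ball x r \<times> UNIV \<inter> D \<times> {t0..}"
    using r(1) x t unfolding eventually_at_topological
    by (intro exI[of _ "ball x r \<times> UNIV"]) (auto intro: open_Times)
  then have "\<forall>\<^sub>F q in ?F. norm ((case q of (x, t) \<Rightarrow> F x t) - F x t) \<le> L * (norm (fst q - x) + \<bar>snd q - t\<bar>)"
  proof (rule eventually_mono)
    fix q assume "q \<in> ball x r \<times> UNIV \<inter> D \<times> {t0..}"
    then show "norm ((case q of (x, t) \<Rightarrow> F x t) - F x t) \<le> L * (norm (fst q - x) + \<bar>snd q - t\<bar>)"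
      using F[unfolded ball_Lipschitz_def, rule_format, OF r(2), of "fst q" x "snd q" t] r(1) t by (simp add: case_prod_beta mem_Times_iff)
  qed
  from Lim_null_comparison[OF this lim]
  show "((\<lambda>(x, t). F x t) \<longlongrightarrow> F x t) ?F"
    by (rule Lim_null[THEN iffD2])
qed

text \<open>No chain rule is needed here: the bound is local by assumption and adds up along the curve.\<close>

lemma ball_Lipschitz_along_curve:
  assumes D: "open D" and F: "ball_Lipschitz D t0 F L" and L: "0 \<le> L" and "t0 \<le> a" "a \<le> b"
    and yD: "\<And>t. t \<in> {a..b} \<Longrightarrow> y t \<in> D"
    and y: "\<And>s t. \<lbrakk>a \<le> s; s \<le> t; t \<le> b\<rbrakk> \<Longrightarrow> norm (y t - y s) \<le> m * (t - s)"
    and m: "0 \<le> m"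
  shows "norm (F (y b) b - F (y a) a) \<le> L * (1 + m) * (b - a)"
proof -
  have "a \<le> a \<longrightarrow> b \<le> b \<longrightarrow> norm (F (y b) b - F (y a) a) \<le> L * (1 + m) * (b - a)"
    using \<open>a \<le> b\<close>
  \<comment> \<open>The estimate is additive over adjacent intervals, so by bisection it is enough
    to prove it on short intervals around each point.\<close>
  proof (induction rule: Bolzano[where P = "\<lambda>s t. a \<le> s \<longrightarrow> t \<le> b \<longrightarrow>
        norm (F (y t) t - F (y s) s) \<le> L * (1 + m) * (t - s)"])
    case (trans p q r)
    show ?case
    proof (intro impI)
      assume "a \<le> p" "r \<le> b"
      with trans have "norm (F (y q) q - F (y p) p) \<le> L * (1 + m) * (q - p)"
        "norm (F (y r) r - F (y q) q) \<le> L * (1 + m) * (r - q)" by auto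
      then show "norm (F (y r) r - F (y p) p) \<le> L * (1 + m) * (r - p)"
        using norm_triangle_ineq[of "F (y q) q - F (y p) p" "F (y r) r - F (y q) q"]
        by (simp add: algebra_simps)
    qed
  next
    case (local x)
    then have "y x \<in> D" using yD by simp
    then obtain r where r: "r > 0" "ball (y x) r \<subseteq> D" using D open_contains_ball by blast
    \<comment> \<open>At speed at most m the curve stays in the ball for this long; 1 + m also
      covers m = 0.\<close>
    define d where "d = r / (1 + m)"
    have "d > 0" using r m by (simp add: d_def)
    have "norm (F (y t) t - F (y s) s) \<le> L * (1 + m) * (t - s)"
      if "s \<le> x" "x \<le> t" "t - s < d" "a \<le> s" "t \<le> b" for s t
    proof -
      have "(1 + m) * (t - s) < r" using that(3) m by (simp add: d_def field_simps)
      moreover have "m * (x - s) \<le> (1 + m) * (t - s)" "m * (t - x) \<le> (1 + m) * (t - s)"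
        using that m by (auto intro!: mult_mono)
      ultimately have "norm (y x - y s) < r" "norm (y t - y x) < r"
        using y[of s x] y[of x t] that by linarith+
      then have in_ball: "y t \<in> ball (y x) r" "y s \<in> ball (y x) r"
        by (auto simp: dist_norm norm_minus_commute)
      have "t0 \<le> t" "t0 \<le> s" using that \<open>t0 \<le> a\<close> by auto
      then have "norm (F (y t) t - F (y s) s) \<le> L * (norm (y t - y s) + \<bar>t - s\<bar>)"
        by (rule F[unfolded ball_Lipschitz_def, rule_format, OF r(2) in_ball])
      also have "\<dots> \<le> L * (m * (t - s) + (t - s))"
        using y[of s t] that L by (intro mult_left_mono) auto
      finally show ?thesis by (simp add: algebra_simps)
    qed
    with \<open>d > 0\<close> show ?case by blast
  qed
  then show ?thesis by simp
qed

lemma bounded_bilinear_matrix_vector_mult: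
  "bounded_bilinear (\<lambda>(A :: real^'n^'m) x. A *v x)"
  by (rule bounded_bilinear.intro)
    (auto simp: matrix_vector_mult_add_rdistrib matrix_vector_right_distrib
      scaleR_matrix_vector_assoc matrix_vector_mult_scaleR
      intro!: exI[of _ 1] norm_matrix_vector_mult_le)

text \<open>This is the only source of information on M: the bound and the continuity of the
  gradient of A pass to it. \<open>u_regular\<close> provides derivatives of both summands, so the
  derivative of the sum splits.\<close>

lemma jac_A_u:
  assumes "u_regular D t0 u" "x \<in> D" "t0 \<le> t"
  shows "jac (\<lambda>y. A_u \<gamma> \<mu> u y t) x = M_u \<gamma> \<mu> u x t"
proof (rule jac_eqI)
  have "((\<lambda>y. u y t) has_derivative (\<lambda>h. jac (\<lambda>y. u y t) x *v h)) (at x)"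
    and "((\<lambda>y. lap (\<lambda>z. u z t) y) has_derivative (\<lambda>h. jac (\<lambda>y. lap (\<lambda>z. u z t) y) x *v h)) (at x)"
    using assms by (auto intro!: has_derivative_jac simp: u_regular_def)
  then have "((\<lambda>y. A_u \<gamma> \<mu> u y t) has_derivative (\<lambda>h. jac (\<lambda>y. u y t) x *v h
      + (\<gamma> / (6 * \<mu>)) *\<^sub>R (jac (\<lambda>y. lap (\<lambda>z. u z t) y) x *v h))) (at x)"
    unfolding A_u_def by (intro derivative_intros)
  then show "((\<lambda>y. A_u \<gamma> \<mu> u y t) has_derivative (\<lambda>h. M_u \<gamma> \<mu> u x t *v h)) (at x)"
    unfolding M_u_def by (simp add: matrix_vector_mult_add_rdistrib scaleR_matrix_vector_assoc)
qed

section \<open>The Maxey--Riley system\<close>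

text \<open>Projections and inclusions are bounded linear, so the position and velocity equations
  can be treated as one equation in the product.\<close>

lemma has_integral_Pair_iff:
  fixes f :: "real \<Rightarrow> 'a::euclidean_space \<times> 'b::euclidean_space"
  shows "(f has_integral i) S \<longleftrightarrow>
    ((\<lambda>x. fst (f x)) has_integral fst i) S \<and> ((\<lambda>x. snd (f x)) has_integral snd i) S"
proof
  assume f: "(f has_integral i) S"
  show "((\<lambda>x. fst (f x)) has_integral fst i) S \<and> ((\<lambda>x. snd (f x)) has_integral snd i) S"
    using has_integral_linear[OF f bounded_linear_fst] has_integral_linear[OF f bounded_linear_snd]
    by (simp add: o_def)
next
  assume f: "((\<lambda>x. fst (f x)) has_integral fst i) S \<and> ((\<lambda>x. snd (f x)) has_integral snd i) S"
  have "bounded_linear (\<lambda>x::'a. (x, 0::'b))" "bounded_linear (\<lambda>x::'b. (0::'a, x))"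
    by (auto intro!: bounded_linear_Pair bounded_linear_ident bounded_linear_zero)
  from has_integral_add[OF has_integral_linear[OF conjunct1[OF f] this(1)] has_integral_linear[OF conjunct2[OF f] this(2)]]
  show "(f has_integral i) S" by (simp add: o_def)
qed

text \<open>The origin of the fields in u is forgotten. The single constant L is both the Lipschitz
  constant of A and B and the bound on M, and k is the coefficient of the Abel term.\<close>

locale MR_system =
  fixes D :: "(real^'n) set" and t0 \<mu> k L :: real
    and A B :: "real^'n \<Rightarrow> real \<Rightarrow> real^'n" and M :: "real^'n \<Rightarrow> real \<Rightarrow> real^'n^'n"
  assumes D: "open D" and nonneg: "0 \<le> \<mu>" "0 \<le> k" "0 \<le> L"
    and A: "ball_Lipschitz D t0 A L" and B: "ball_Lipschitz D t0 B L"
    and M: "continuous_on (D \<times> {t0..}) (\<lambda>(x, t). M x t)"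
    and M_le: "\<And>x t. x \<in> D \<Longrightarrow> t0 \<le> t \<Longrightarrow> norm (M x t) \<le> L"
begin

definition G :: "real \<times> (real^'n) \<times> (real^'n) \<Rightarrow> (real^'n) \<times> (real^'n)" where
  "G = (\<lambda>(t, x, v). (v + A x t, - \<mu> *\<^sub>R v - M x t *v v + B x t))"

definition P :: "real \<times> (real^'n) \<times> (real^'n) \<Rightarrow> (real^'n) \<times> (real^'n)" where
  "P = (\<lambda>(t, x, v). (0, - k *\<^sub>R v))"

definition solves :: "(real^'n) \<times> (real^'n) \<Rightarrow> real set \<Rightarrow> (real \<Rightarrow> (real^'n) \<times> (real^'n)) \<Rightarrow> bool" where
  "solves h I z \<longleftrightarrow> continuous_on I z \<and> (\<forall>t\<in>I. fst (z t) \<in> D \<and>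
     z t = h + volterra t0 (\<lambda>s. G (s, z s)) (\<lambda>s. P (s, z s)) t)"

lemma solvesD:
  assumes "solves h I z"
  shows "continuous_on I z" "\<And>t. t \<in> I \<Longrightarrow> fst (z t) \<in> D"
    "\<And>t. t \<in> I \<Longrightarrow> z t = h + volterra t0 (\<lambda>s. G (s, z s)) (\<lambda>s. P (s, z s)) t"
  using assms unfolding solves_def by blast+

lemma continuous_on_field:
  assumes "continuous_on I z" "\<And>t. t \<in> I \<Longrightarrow> t0 \<le> t \<and> fst (z t) \<in> D" and F: "continuous_on (D \<times> {t0..}) (\<lambda>(x, t). F x t)"
  shows "continuous_on I (\<lambda>t. F (fst (z t)) t)"
proof -
  have "continuous_on I (\<lambda>t. (\<lambda>(x, t). F x t) (fst (z t), t))"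
    using assms(1,2) by (intro continuous_on_compose2[OF F] continuous_intros) auto
  then show ?thesis by simp
qed

lemma continuous_on_A: "continuous_on (D \<times> {t0..}) (\<lambda>(x, t). A x t)"
  and continuous_on_B: "continuous_on (D \<times> {t0..}) (\<lambda>(x, t). B x t)"
  using D A B by (auto intro: ball_Lipschitz_imp_continuous_on)

lemma continuous_on_G: "continuous_on ({t0..} \<times> D \<times> UNIV) G"
  and continuous_on_P: "continuous_on ({t0..} \<times> D \<times> UNIV) P"
proof -
  have F: "continuous_on ({t0..} \<times> D \<times> UNIV) (\<lambda>q. F (fst (snd q)) (fst q))"
    if F: "continuous_on (D \<times> {t0..}) (\<lambda>(x, t). F x t)"
    for F :: "real^'n \<Rightarrow> real \<Rightarrow> 'b::topological_space"
  proof -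
    have "continuous_on ({t0..} \<times> D \<times> UNIV) (\<lambda>q. (\<lambda>(x, t). F x t) (fst (snd q), fst q))"
      by (intro continuous_on_compose2[OF F] continuous_intros) auto
    then show ?thesis by simp
  qed
  show "continuous_on ({t0..} \<times> D \<times> UNIV) G" unfolding G_def case_prod_beta
    by (intro continuous_intros F continuous_on_A continuous_on_B M
        bounded_bilinear.continuous_on[OF bounded_bilinear_matrix_vector_mult])
  show "continuous_on ({t0..} \<times> D \<times> UNIV) P" unfolding P_def case_prod_beta
    by (intro continuous_intros)
qed

lemma continuous_on_G_P:
  assumes "continuous_on I z" "\<And>t. t \<in> I \<Longrightarrow> t0 \<le> t \<and> fst (z t) \<in> D"
  shows "continuous_on I (\<lambda>s. G (s, z s))" "continuous_on I (\<lambda>s. P (s, z s))"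
proof -
  have sub: "(\<lambda>s. (s, z s)) ` I \<subseteq> {t0..} \<times> D \<times> UNIV"
  proof (rule image_subsetI)
    fix s assume "s \<in> I"
    from assms(2)[OF this] show "(s, z s) \<in> {t0..} \<times> D \<times> UNIV" by (simp add: mem_Times_iff)
  qed
  have "continuous_on I (\<lambda>s. (s, z s))" using assms(1) by (intro continuous_intros)
  then show "continuous_on I (\<lambda>s. G (s, z s))" "continuous_on I (\<lambda>s. P (s, z s))"
    using continuous_on_compose2[OF continuous_on_G _ sub] continuous_on_compose2[OF continuous_on_P _ sub]
    by auto
qed

text \<open>\<open>integral\<close> has a default value on non-integrable functions, so the step to
  \<open>has_integral\<close> rests on integrability, which continuity of z and of the fields
  provides.\<close>

lemma volterra_equation_iff:
  assumes "continuous_on {t0..t} z" "\<And>s. s \<in> {t0..t} \<Longrightarrow> fst (z s) \<in> D" "t0 \<le> t"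
  shows "z t = h + volterra t0 (\<lambda>s. G (s, z s)) (\<lambda>s. P (s, z s)) t \<longleftrightarrow>
    ((\<lambda>s. snd (z s) + A (fst (z s)) s) has_integral (fst (z t) - fst h)) {t0..t} \<and>
    ((\<lambda>s. - \<mu> *\<^sub>R snd (z s) - M (fst (z s)) s *v snd (z s)
        - (k / sqrt (t - s)) *\<^sub>R snd (z s) + B (fst (z s)) s) has_integral (snd (z t) - snd h)) {t0..t}"
proof -
  let ?f = "\<lambda>s. G (s, z s) + (1 / sqrt (t - s)) *\<^sub>R P (s, z s)"
  have "?f integrable_on {t0..t}"
    using assms by (intro volterra_integrable continuous_on_G_P) auto
  then have "z t = h + volterra t0 (\<lambda>s. G (s, z s)) (\<lambda>s. P (s, z s)) t \<longleftrightarrow> (?f has_integral (z t - h)) {t0..t}"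
    unfolding volterra_def has_integral_iff eq_diff_eq by (auto simp only: add.commute simp_thms)
  also have "(\<lambda>s. fst (?f s)) = (\<lambda>s. snd (z s) + A (fst (z s)) s)"
    by (simp add: G_def P_def case_prod_beta)
  moreover have "(\<lambda>s. snd (?f s)) = (\<lambda>s. - \<mu> *\<^sub>R snd (z s) - M (fst (z s)) s *v snd (z s)
        - (k / sqrt (t - s)) *\<^sub>R snd (z s) + B (fst (z s)) s)"
    by (simp add: G_def P_def case_prod_beta diff_add_eq)
  ultimately show ?thesis by (simp add: has_integral_Pair_iff)
qed

section \<open>A priori bound and behaviour at the endpoint\<close>

text \<open>Instead of Gronwall's inequality: on a short final interval the growth of
  \<open>\<phi>\<close> is at most half of its maximum, which is absorbed into the left-hand side.\<close>

lemma bounded_vector_field_along_solution: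
  assumes z: "solves h {t0..<T} z" and "t0 < T"
  obtains C where "\<And>t. t \<in> {t0..<T} \<Longrightarrow> norm (G (t, z t)) \<le> C"
    "\<And>t. t \<in> {t0..<T} \<Longrightarrow> norm (P (t, z t)) \<le> C"
proof -
  note zc = solvesD(1)[OF z] and zD = solvesD(2)[OF z] and z_eq = solvesD(3)[OF z]
  have "t0 \<le> t \<and> fst (z t) \<in> D" if "t \<in> {t0..<T}" for t using zD[OF that] that by simp
  note cA = continuous_on_field[OF zc this continuous_on_A]
    and cB = continuous_on_field[OF zc this continuous_on_B]
  define \<phi> where "\<phi> t = norm (snd (z t)) + norm (A (fst (z t)) t) + norm (B (fst (z t)) t)" for t
  have \<phi>: "continuous_on {t0..<T} \<phi>"
    unfolding \<phi>_def by (intro continuous_intros zc cA cB)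
  have \<phi>0: "0 \<le> \<phi> t" for t by (simp add: \<phi>_def)
  \<comment> \<open>The two components of G contribute 1 and \<mu> + L + 1, and P contributes
    k.\<close>
  define K where "K = 2 + \<mu> + L + k"
  have K: "K > 0" using nonneg by (simp add: K_def)
  have G_le: "norm (G (t, z t)) \<le> K * \<phi> t" if t: "t \<in> {t0..<T}" for t
  proof -
    let ?x = "fst (z t)" and ?v = "snd (z t)"
    have v: "norm ?v \<le> \<phi> t" and b: "norm (B ?x t) \<le> \<phi> t" by (auto simp: \<phi>_def)
    have "norm (G (t, z t)) \<le> norm (?v + A ?x t) + norm (- \<mu> *\<^sub>R ?v - M ?x t *v ?v + B ?x t)"
      unfolding G_def case_prod_beta using norm_Pair_le by simp
    moreover have "norm (?v + A ?x t) \<le> \<phi> t"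
      using norm_triangle_ineq[of ?v "A ?x t"] by (simp add: \<phi>_def add_increasing2)
    moreover have "norm (- \<mu> *\<^sub>R ?v - M ?x t *v ?v + B ?x t) \<le> \<mu> * \<phi> t + L * \<phi> t + \<phi> t"
    proof (intro norm_triangle_mono norm_triangle_le_diff add_mono)
      show "norm (- \<mu> *\<^sub>R ?v) \<le> \<mu> * \<phi> t" using v nonneg by (simp add: mult_left_mono)
      have "norm (M ?x t *v ?v) \<le> norm (M ?x t) * norm ?v" by (rule norm_matrix_vector_mult_le)
      also have "\<dots> \<le> L * \<phi> t" using M_le[OF zD[OF t]] t v nonneg by (intro mult_mono) auto
      finally show "norm (M ?x t *v ?v) \<le> L * \<phi> t" .
    qed (use b in auto)
    moreover have "0 \<le> k * \<phi> t" using nonneg \<phi>0 by simp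
    ultimately show ?thesis by (simp add: K_def algebra_simps)
  qed
  have P_le: "norm (P (t, z t)) \<le> K * \<phi> t" for t
  proof -
    have "norm (P (t, z t)) = k * norm (snd (z t))" using nonneg by (simp add: P_def case_prod_beta)
    also have "\<dots> \<le> K * \<phi> t" using nonneg by (intro mult_mono) (auto simp: \<phi>_def K_def)
    finally show ?thesis .
  qed
  \<comment> \<open>The position component of P vanishes, so y is Lipschitz and not merely Hoelder;
    this allows A and B to be followed along the curve.\<close>
  have y_Lip: "norm (fst (z b) - fst (z a)) \<le> m * (b - a)"
    if ab: "t0 \<le> a" "a \<le> b" "b < T" and m: "\<And>t. t \<in> {a..b} \<Longrightarrow> \<phi> t \<le> m" for a b m
  proof -
    let ?f = "\<lambda>s. snd (z s) + A (fst (z s)) s"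
    have f: "continuous_on {t0..<T} ?f" by (intro continuous_intros zc cA)
    have int: "(?f has_integral (fst (z t) - fst h)) {t0..t}" if "t0 \<le> t" "t < T" for t
    proof -
      have "continuous_on {t0..t} z" using zc by (rule continuous_on_subset) (use that in auto)
      moreover have "z t = h + volterra t0 (\<lambda>s. G (s, z s)) (\<lambda>s. P (s, z s)) t"
        using that by (intro z_eq) auto
      ultimately show ?thesis using volterra_equation_iff[of t z h] zD that by simp
    qed
    have "integral {t0..a} ?f + integral {a..b} ?f = integral {t0..b} ?f"
      using ab int[of b] by (intro Henstock_Kurzweil_Integration.integral_combine) auto
    then have "fst (z b) - fst (z a) = integral {a..b} ?f"
      using integral_unique[OF int[of a]] integral_unique[OF int[of b]] ab by (simp add: algebra_simps)
    also have "norm \<dots> \<le> m * (b - a)"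
    proof (intro integral_bound ab continuous_on_subset[OF f])
      fix t assume "t \<in> {a..b}"
      then show "norm (?f t) \<le> m" using m[of t] norm_triangle_ineq[of "snd (z t)" "A (fst (z t)) t"]
        norm_ge_zero[of "B (fst (z t)) t"] unfolding \<phi>_def by linarith
    qed (use ab in auto)
    finally show ?thesis .
  qed
  \<comment> \<open>Length of the final interval. Relative to the maximum of \<phi>, the first two
    terms bound the growth of w and the third that of A and B together; the smallness condition does
    not involve the size of the solution.\<close>
  obtain \<eta> where \<eta>: "0 < \<eta>" "\<eta> < T - t0" "K * \<eta> + 4 * K * sqrt \<eta> + 2 * L * \<eta> < 1 / 2"
  proof -
    have "((\<lambda>\<eta>. K * \<eta> + 4 * K * sqrt \<eta> + 2 * L * \<eta>) \<longlongrightarrow> K * 0 + 4 * K * sqrt 0 + 2 * L * 0) (at_right 0)"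
      by (intro tendsto_intros)
    then have "\<forall>\<^sub>F \<eta> in at_right 0. K * \<eta> + 4 * K * sqrt \<eta> + 2 * L * \<eta> < 1 / 2"
      by (rule order_tendstoD(2)) simp
    moreover have "\<forall>\<^sub>F \<eta> in at_right 0. \<eta> < T - t0 \<and> 0 < \<eta>"
      using \<open>t0 < T\<close> by (intro eventually_conj order_tendstoD(2)[OF tendsto_ident_at] eventually_at_right_less) auto
    ultimately show thesis
      using that eventually_happens'[OF trivial_limit_at_right_real] eventually_conj by (metis (mono_tags, lifting))
  qed
  define c where "c = T - \<eta>"
  have c: "t0 < c" "c < T" using \<eta> by (auto simp: c_def)
  have "continuous_on {t0..c} \<phi>" using \<phi> by (rule continuous_on_subset) (use c in auto)
  then obtain m0 where m0: "\<And>t. t \<in> {t0..c} \<Longrightarrow> \<phi> t \<le> m0"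
    using continuous_attains_sup[of "{t0..c}" \<phi>] c by force
  have m00: "0 \<le> m0" using m0[of c] \<phi>0[of c] c by simp
  \<comment> \<open>The constant solves m \<le> m0 + m/2 + 2 L \<eta> for the running maximum m; the
    last term reflects the explicit time dependence of A and B.\<close>
  have \<phi>_le: "\<phi> t \<le> 2 * m0 + 4 * L * \<eta>" if t: "t \<in> {t0..<T}" for t
  proof -
    have "continuous_on {t0..t} \<phi>" using \<phi> by (rule continuous_on_subset) (use t in auto)
    \<comment> \<open>The maximum is taken from t0 and not from c, because the memory term at q
      involves the fields on all of [t0, q].\<close>
    then obtain q where q: "q \<in> {t0..t}" and max: "\<And>s. s \<in> {t0..t} \<Longrightarrow> \<phi> s \<le> \<phi> q"
      using continuous_attains_sup[of "{t0..t}" \<phi>] t by auto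
    define m where "m = \<phi> q"
    have m_ge: "0 \<le> m" and m: "\<And>s. s \<in> {t0..q} \<Longrightarrow> \<phi> s \<le> m" using \<phi>0 max q by (auto simp: m_def)
    have "m \<le> 2 * m0 + 4 * L * \<eta>"
    proof (cases "q \<le> c")
      case True
      then show ?thesis using m0[of q] q m00 nonneg \<eta> by (simp add: m_def add_increasing2)
    next
      case False
      then have q': "c < q" "q < T" "q - c \<le> \<eta>" using q t by (auto simp: c_def)
      have sub: "{t0..q} \<subseteq> {t0..<T}" using q' by auto
      have Km: "norm (G (s, z s)) \<le> K * m" "norm (P (s, z s)) \<le> K * m" if "s \<in> {t0..q}" for s
      proof -
        have "K * \<phi> s \<le> K * m" using K m[OF that] by simp
        then show "norm (G (s, z s)) \<le> K * m" "norm (P (s, z s)) \<le> K * m"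
          using G_le[of s] P_le[of s] that sub by auto
      qed
      have "norm (z q - z c) \<le> K * m * (q - c) + 4 * (K * m) * sqrt (q - c)"
      proof -
        have "norm (volterra t0 (\<lambda>s. G (s, z s)) (\<lambda>s. P (s, z s)) q
            - volterra t0 (\<lambda>s. G (s, z s)) (\<lambda>s. P (s, z s)) c) \<le> K * m * (q - c) + 4 * (K * m) * sqrt (q - c)"
          using c q' sub zD
          by (intro volterra_Holder continuous_on_G_P continuous_on_subset[OF zc] Km) auto
        then show ?thesis using z_eq[of q] z_eq[of c] c q' by simp
      qed
      also have "\<dots> \<le> K * m * \<eta> + 4 * (K * m) * sqrt \<eta>"
        using q' K m_ge by (intro add_mono mult_left_mono) auto
      finally have le: "norm (z q - z c) \<le> m * (K * \<eta> + 4 * K * sqrt \<eta>)"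
        by (simp add: algebra_simps)
      have "norm (snd (z q) - snd (z c)) \<le> norm (z q - z c)"
        by (metis norm_snd_le prod.collapse snd_diff)
      also note le
      finally have "norm (snd (z q) - snd (z c)) \<le> m * (K * \<eta> + 4 * K * sqrt \<eta>)" .
      then have "norm (snd (z q)) \<le> norm (snd (z c)) + m * (K * \<eta> + 4 * K * sqrt \<eta>)"
        using norm_triangle_sub[of "snd (z q)" "snd (z c)"] by linarith
      moreover have "norm (F (fst (z q)) q) \<le> norm (F (fst (z c)) c) + L * (1 + m) * \<eta>"
        if F: "ball_Lipschitz D t0 F L" for F :: "real^'n \<Rightarrow> real \<Rightarrow> real^'n"
      proof -
        have "norm (F (fst (z q)) q - F (fst (z c)) c) \<le> L * (1 + m) * (q - c)"
          using c q' zD m m_ge nonneg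
          by (intro ball_Lipschitz_along_curve[OF D F] y_Lip) auto
        also have "\<dots> \<le> L * (1 + m) * \<eta>" using q' nonneg m_ge by (intro mult_left_mono) auto
        finally show ?thesis using norm_triangle_sub[of "F (fst (z q)) q" "F (fst (z c)) c"] by linarith
      qed
      note this[OF A] this[OF B]
      ultimately have "m \<le> \<phi> c + m * (K * \<eta> + 4 * K * sqrt \<eta> + 2 * L * \<eta>) + 2 * L * \<eta>"
        unfolding m_def \<phi>_def[of q] \<phi>_def[of c] by (simp add: algebra_simps)
      also have "\<dots> \<le> m0 + m * (1 / 2) + 2 * L * \<eta>"
        using m0[of c] c m_ge \<eta>(3) nonneg by (intro add_mono mult_left_mono) auto
      finally show ?thesis by simp
    qed
    then show ?thesis using max[of t] t by (simp add: m_def)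
  qed
  have le: "K * \<phi> t \<le> K * (2 * m0 + 4 * L * \<eta>)" if "t \<in> {t0..<T}" for t
    using \<phi>_le[OF that] K by simp
  show thesis
    using that order_trans[OF G_le le] order_trans[OF P_le le] by blast
qed

text \<open>Bounded fields make z uniformly continuous up to the open end, and such maps extend to
  the closure. The endpoint value may at this stage lie outside D.\<close>

lemma solution_extends_to_endpoint:
  assumes z: "solves h {t0..<T} z" and "t0 < T"
  obtains z' where "uniformly_continuous_on {t0..T} z'" "\<And>t. t \<in> {t0..<T} \<Longrightarrow> z' t = z t"
proof -
  obtain C where C: "\<And>t. t \<in> {t0..<T} \<Longrightarrow> norm (G (t, z t)) \<le> C"
    "\<And>t. t \<in> {t0..<T} \<Longrightarrow> norm (P (t, z t)) \<le> C"
    using bounded_vector_field_along_solution[OF assms] by blast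
  have zD: "t0 \<le> t \<and> fst (z t) \<in> D" if "t \<in> {t0..<T}" for t
    using solvesD(2)[OF z that] that by simp
  have "uniformly_continuous_on {t0..<T} (volterra t0 (\<lambda>s. G (s, z s)) (\<lambda>s. P (s, z s)))"
    by (rule uniformly_continuous_on_volterra[OF _ continuous_on_G_P[OF solvesD(1)[OF z] zD] C]) auto
  then have "uniformly_continuous_on {t0..<T} (\<lambda>t. h + volterra t0 (\<lambda>s. G (s, z s)) (\<lambda>s. P (s, z s)) t)"
    by (intro uniformly_continuous_on_add uniformly_continuous_on_const)
  moreover have "h + volterra t0 (\<lambda>s. G (s, z s)) (\<lambda>s. P (s, z s)) t = z t" if "t \<in> {t0..<T}" for t
    using solvesD(3)[OF z that] by simp
  ultimately have uc: "uniformly_continuous_on {t0..<T} z"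
    unfolding uniformly_continuous_on_def by simp
  show thesis
  proof (rule uniformly_continuous_on_extension_on_closure[OF uc])
    fix z' assume "uniformly_continuous_on (closure {t0..<T}) z'" "\<And>t. t \<in> {t0..<T} \<Longrightarrow> z t = z' t"
    then show thesis using \<open>t0 < T\<close> by (intro that[of z']) auto
  qed
qed

text \<open>The limit at T exists, and positions lie in the closed set S at times accumulating at T,
  so the limit position is in S and hence in D. The equation then holds at T too, and the closed
  interval serves as prescribed past.\<close>

lemma solution_continues_beyond_endpoint:
  assumes z: "solves h {t0..<T} z" and "t0 < T" and "compact S" "S \<subseteq> D"
    and S: "\<And>\<tau>. t0 < \<tau> \<Longrightarrow> \<tau> < T \<Longrightarrow> \<exists>t. \<tau> < t \<and> t < T \<and> fst (z t) \<in> S"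
  obtains T' z' where "T < T'" "solves h {t0..<T'} z'" "\<And>t. t \<in> {t0..<T} \<Longrightarrow> z' t = z t"
proof -
  obtain \<zeta> where uc: "uniformly_continuous_on {t0..T} \<zeta>" and \<zeta>z: "\<And>t. t \<in> {t0..<T} \<Longrightarrow> \<zeta> t = z t"
    using solution_extends_to_endpoint[OF assms(1,2)] by blast
  have \<zeta>: "continuous_on {t0..T} \<zeta>" using uc by (rule uniformly_continuous_imp_continuous)
  have \<zeta>D: "fst (\<zeta> t) \<in> D" if "t \<in> {t0..<T}" for t using solvesD(2)[OF z that] \<zeta>z[OF that] by simp
  have lim: "((\<lambda>t. \<zeta> t) \<longlongrightarrow> \<zeta> T) (at_left T)"
  proof -
    have "(\<zeta> \<longlongrightarrow> \<zeta> T) (at T within {t0..T})" using \<zeta> \<open>t0 < T\<close> by (simp add: continuous_on_def)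
    then show ?thesis using \<open>t0 < T\<close> by (simp add: at_within_Icc_at_left)
  qed
  have "fst (\<zeta> T) \<in> S"
  proof (rule ccontr)
    assume "fst (\<zeta> T) \<notin> S"
    then have "\<forall>\<^sub>F t in at_left T. fst (\<zeta> t) \<in> - S"
      using tendsto_fst[OF lim] compact_imp_closed[OF \<open>compact S\<close>]
      by (intro topological_tendstoD) auto
    then obtain b where b: "b < T" "\<And>t. b < t \<Longrightarrow> t < T \<Longrightarrow> fst (\<zeta> t) \<notin> S"
      unfolding eventually_at_left[OF \<open>t0 < T\<close>] by auto
    \<comment> \<open>The midpoint ensures t0 < \<tau>, as b may lie before t0.\<close>
    define \<tau> where "\<tau> = max b ((t0 + T) / 2)"
    have "t0 < \<tau>" "\<tau> < T" using \<open>t0 < T\<close> b(1) by (auto simp: \<tau>_def less_max_iff_disj)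
    then obtain t where "\<tau> < t" "t < T" "fst (z t) \<in> S" using S by blast
    moreover have "b < t" "t0 < t" using \<open>\<tau> < t\<close> \<open>t0 < \<tau>\<close> \<tau>_def by linarith+
    ultimately show False using b(2)[of t] \<zeta>z[of t] by simp
  qed
  then have \<zeta>D: "fst (\<zeta> t) \<in> D" if "t \<in> {t0..T}" for t
    using \<zeta>D \<open>S \<subseteq> D\<close> that by (cases "t = T") auto
  let ?V = "\<lambda>z. volterra t0 (\<lambda>s. G (s, z s)) (\<lambda>s. P (s, z s))"
  have \<zeta>_eq: "\<zeta> t = h + ?V \<zeta> t" if "t \<in> {t0..<T}" for t
  proof -
    have "?V \<zeta> t = ?V z t" using that \<zeta>z by (intro volterra_cong) auto
    with solvesD(3)[OF z that] \<zeta>z[OF that] show ?thesis by simp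
  qed
  \<comment> \<open>Both sides of the equation are continuous up to T and agree before T, so they
    agree at T.\<close>
  have "continuous_on {t0..T} (\<lambda>t. h + ?V \<zeta> t)"
    using \<zeta> \<zeta>D by (intro continuous_intros continuous_on_volterra continuous_on_G_P) auto
  then have "((\<lambda>t. h + ?V \<zeta> t) \<longlongrightarrow> h + ?V \<zeta> T) (at T within {t0..T})"
    using \<open>t0 < T\<close> by (simp add: continuous_on_def)
  then have "((\<lambda>t. h + ?V \<zeta> t) \<longlongrightarrow> h + ?V \<zeta> T) (at_left T)"
    using \<open>t0 < T\<close> by (simp add: at_within_Icc_at_left)
  moreover have "\<forall>\<^sub>F t in at_left T. h + ?V \<zeta> t = \<zeta> t"
    unfolding eventually_at_left[OF \<open>t0 < T\<close>] using \<open>t0 < T\<close> \<zeta>_eq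
    by (intro exI[of _ t0]) auto
  ultimately have "(\<zeta> \<longlongrightarrow> h + ?V \<zeta> T) (at_left T)" by (rule Lim_transform_eventually)
  with lim have "\<zeta> T = h + ?V \<zeta> T" by (intro tendsto_unique) auto
  with \<zeta>_eq have \<zeta>_eq': "\<zeta> t = h + ?V \<zeta> t" if "t \<in> {t0..T}" for t
    using that by (cases "t = T") auto
  obtain b z' where b: "T < b" and z': "continuous_on {t0..b} z'"
    and z'\<zeta>: "\<And>t. t \<in> {t0..T} \<Longrightarrow> z' t = \<zeta> t"
    and z'D: "\<And>t. t \<in> {t0..b} \<Longrightarrow> z' t \<in> D \<times> UNIV"
    and z'_eq: "\<And>t. t \<in> {t0..b} \<Longrightarrow> z' t = h + ?V z' t"
    using volterra_continuation[OF less_imp_le[OF \<open>t0 < T\<close>] open_Times[OF D open_UNIV]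
        continuous_on_G continuous_on_P \<zeta> _ \<zeta>_eq'] \<zeta>D by (auto simp: mem_Times_iff)
  show thesis
  proof (rule that[OF b])
    have "continuous_on {t0..<b} z'" using z' by (rule continuous_on_subset) auto
    moreover have "fst (z' t) \<in> D \<and> z' t = h + ?V z' t" if "t \<in> {t0..<b}" for t
    proof -
      have t: "t \<in> {t0..b}" using that by simp
      show ?thesis using z'D[OF t] z'_eq[OF t] unfolding mem_Times_iff by blast
    qed
    ultimately show "solves h {t0..<b} z'" unfolding solves_def by blast
  qed (use z'\<zeta> \<zeta>z in simp)
qed

end

section \<open>Return to the original system and conclusion\<close>

lemma (in MR_system) solves_iff_integral_equations:
  "solves h {t0..<T} z \<longleftrightarrow> continuous_on {t0..<T} z \<and> (\<forall>t\<in>{t0..<T}. fst (z t) \<in> D \<and>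
    ((\<lambda>s. snd (z s) + A (fst (z s)) s) has_integral (fst (z t) - fst h)) {t0..t} \<and>
    ((\<lambda>s. - \<mu> *\<^sub>R snd (z s) - M (fst (z s)) s *v snd (z s)
        - (k / sqrt (t - s)) *\<^sub>R snd (z s) + B (fst (z s)) s) has_integral (snd (z t) - snd h)) {t0..t})"
proof (cases "continuous_on {t0..<T} z \<and> (\<forall>t\<in>{t0..<T}. fst (z t) \<in> D)")
  case True
  then have "z t = h + volterra t0 (\<lambda>s. G (s, z s)) (\<lambda>s. P (s, z s)) t \<longleftrightarrow>
    ((\<lambda>s. snd (z s) + A (fst (z s)) s) has_integral (fst (z t) - fst h)) {t0..t} \<and>
    ((\<lambda>s. - \<mu> *\<^sub>R snd (z s) - M (fst (z s)) s *v snd (z s)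
        - (k / sqrt (t - s)) *\<^sub>R snd (z s) + B (fst (z s)) s) has_integral (snd (z t) - snd h)) {t0..t}"
    if "t \<in> {t0..<T}" for t
    using that by (intro volterra_equation_iff) (auto intro: continuous_on_subset)
  with True show ?thesis unfolding solves_def by blast
qed (unfold solves_def, blast)

lemma MR_solution_iff:
  assumes "MR_system D t0 \<mu> (\<kappa> * sqrt \<mu>) L (A_u \<gamma> \<mu> u) (B_u R \<gamma> \<mu> g u) (M_u \<gamma> \<mu> u)"
  shows "MR_solution D t0 R \<mu> \<kappa> \<gamma> g u y0 w0 (ereal T) y w \<longleftrightarrow> t0 < T \<and>
    MR_system.solves D t0 \<mu> (\<kappa> * sqrt \<mu>) (A_u \<gamma> \<mu> u) (B_u R \<gamma> \<mu> g u) (M_u \<gamma> \<mu> u)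
      (y0, w0) {t0..<T} (\<lambda>t. (y t, w t))"
proof -
  have "{t. t0 \<le> t \<and> t < T} = {t0..<T}" by auto
  moreover have "continuous_on {t0..<T} (\<lambda>t. (y t, w t)) \<longleftrightarrow>
      continuous_on {t0..<T} y \<and> continuous_on {t0..<T} w"
    by (auto intro: continuous_on_Pair dest: continuous_on_fst continuous_on_snd)
  ultimately show ?thesis
    unfolding MR_solution_def MR_system.solves_iff_integral_equations[OF assms]
    by (auto simp only: ereal_less_eq less_ereal.simps fst_conv snd_conv atLeastLessThan_iff)
qed

theorem theorem3p5:
  fixes D :: "(real^'n) set" and u :: "real^'n \<Rightarrow> real \<Rightarrow> real^'n"
    and g y0 w0 :: "real^'n" and y w :: "real \<Rightarrow> real^'n"
    and T :: ereal and t0 R \<mu> \<kappa> \<gamma> :: real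
  assumes "open D" and "connected D"
    and "t0 \<ge> 0" and "R > 0" and "\<mu> > 0" and "\<kappa> > 0" and "\<gamma> > 0"
    and "u_regular D t0 u"
    and "assumption_star D t0 R \<gamma> \<mu> g u"
    and "MR_maximal D t0 R \<mu> \<kappa> \<gamma> g u y0 w0 T y w"
    and "T < \<infinity>"
  shows "\<forall>S. compact S \<and> S \<subseteq> D \<times> UNIV \<longrightarrow>
           (\<exists>\<tau>. t0 < \<tau> \<and> ereal \<tau> < T \<and>
              (\<forall>t. \<tau> < t \<and> ereal t < T \<longrightarrow> (y t, w t) \<notin> S))"
proof (intro allI impI, rule ccontr)
  fix S assume S: "compact S \<and> S \<subseteq> D \<times> UNIV"
    and contr: "\<nexists>\<tau>. t0 < \<tau> \<and> ereal \<tau> < T \<and> (\<forall>t. \<tau> < t \<and> ereal t < T \<longrightarrow> (y t, w t) \<notin> S)"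
  have sol: "MR_solution D t0 R \<mu> \<kappa> \<gamma> g u y0 w0 T y w"
    and max: "\<And>T' y' w'. \<lbrakk>T < T'; MR_solution D t0 R \<mu> \<kappa> \<gamma> g u y0 w0 T' y' w';
          \<And>t. t0 \<le> t \<Longrightarrow> ereal t < T \<Longrightarrow> y' t = y t \<and> w' t = w t\<rbrakk> \<Longrightarrow> False"
    using assms(10) unfolding MR_maximal_def by blast+
  have "ereal t0 < T" and "y t0 \<in> D" using sol by (auto simp: MR_solution_def)
  then obtain b where T: "T = ereal b" using \<open>T < \<infinity>\<close> by (cases T) auto
  obtain L where CA: "C1_bounded D t0 (A_u \<gamma> \<mu> u) L" and CB: "C1_bounded D t0 (B_u R \<gamma> \<mu> g u) L"
    using assms(9) unfolding assumption_star_def by blast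
  have M_le: "norm (M_u \<gamma> \<mu> u x t) \<le> L" if "x \<in> D" "t0 \<le> t" for x t
    using CA that jac_A_u[OF assms(8) that, of \<gamma> \<mu>] unfolding C1_bounded_def by (metis less_imp_le)
  have sys: "MR_system D t0 \<mu> (\<kappa> * sqrt \<mu>) L (A_u \<gamma> \<mu> u) (B_u R \<gamma> \<mu> g u) (M_u \<gamma> \<mu> u)"
  proof
    \<comment> \<open>A bound on norms over D forces L to be nonnegative once D has a point, here
      y(t0).\<close>
    show "0 \<le> L" using order_trans[OF norm_ge_zero M_le[OF \<open>y t0 \<in> D\<close> order_refl]] .
    have "continuous_on (D \<times> {t0..}) (\<lambda>(x, t). jac (\<lambda>y. A_u \<gamma> \<mu> u y t) x)"
      using CA by (simp add: C1_bounded_def)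
    then show "continuous_on (D \<times> {t0..}) (\<lambda>(x, t). M_u \<gamma> \<mu> u x t)"
      by (rule continuous_on_eq) (use jac_A_u[OF assms(8)] in auto)
  qed (use assms(1,5,6) M_le CA CB C1_bounded_imp_ball_Lipschitz in auto)
  interpret MR_system D t0 \<mu> "\<kappa> * sqrt \<mu>" L "A_u \<gamma> \<mu> u" "B_u R \<gamma> \<mu> g u" "M_u \<gamma> \<mu> u"
    by (rule sys)
  have z: "solves (y0, w0) {t0..<b} (\<lambda>t. (y t, w t))" and b: "t0 < b"
    using sol unfolding T MR_solution_iff[OF sys] by auto
  have "compact (fst ` S)" using S by (intro compact_continuous_image continuous_intros) auto
  moreover have "fst ` S \<subseteq> D" using S by auto
  \<comment> \<open>Negating the conclusion gives visits to S arbitrarily close to the end of the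
    interval, not a stay in S.\<close>
  moreover have "\<exists>t. \<tau> < t \<and> t < b \<and> fst (y t, w t) \<in> fst ` S" if "t0 < \<tau>" "\<tau> < b" for \<tau>
  proof -
    have "\<exists>t>\<tau>. t < b \<and> (y t, w t) \<in> S" using contr that unfolding T less_ereal.simps by blast
    then obtain t where "\<tau> < t" "t < b" "(y t, w t) \<in> S" by blast
    then show ?thesis by (intro exI conjI imageI)
  qed
  ultimately obtain b' z' where "b < b'" and z': "solves (y0, w0) {t0..<b'} z'"
    and eq: "\<And>t. t \<in> {t0..<b} \<Longrightarrow> z' t = (y t, w t)"
    using solution_continues_beyond_endpoint[OF z b, of "fst ` S"] by blast
  show False
  proof (rule max)
    show "T < ereal b'" using \<open>b < b'\<close> T by simp
    show "MR_solution D t0 R \<mu> \<kappa> \<gamma> g u y0 w0 (ereal b') (\<lambda>t. fst (z' t)) (\<lambda>t. snd (z' t))"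
      unfolding MR_solution_iff[OF sys] using z' b \<open>b < b'\<close> by simp
  qed (use eq T in auto)
qed

end
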